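(* Let $D(a)$ be a complex vector space, $a\colon D(a)\times D(a)\to\mathbf{C}$ a sesquilinear form, $H$ a complex Hilbert space and $j\colon D(a)\to H$ a linear map. Suppose that $a$ is accretive and $j$-sectorial and that $j(D(a))$ is dense in $H$. Let $A$ be the operator associated with $(a,j)$ and $S$ the semigroup generated by $-A$. Let $C\subset H$ be a non-empty closed convex set and $P\colon H\to C$ the orthogonal projection. Then the following are equivalent. (i) $S_tC\subset C$ for all $t>0$. (ii) For all $u\in D(a)$ there exists a Cauchy sequence $w_1,w_2,\ldots$ in $(D(a),\|\cdot\|_a)$ such that $\lim_{n\to\infty}j(w_n)=Pj(u)$ in $H$ and $\lim_{n\to\infty}\operatorname{Re}a(w_n,u-w_n)\ge0$. (iii) For all $u\in D(a)$ there exists a bounded sequence $w_1,w_2,\ldots$ in $(D(a),\|\cdot\|_a)$ such that $\lim_{n\to\infty}j(w_n)=Pj(u)$ in $H$ and $\limsup_{n\to\infty}\operatorname{Re}a(w_n,u-w_n)\ge0$.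
   Context: Sesquilinear forms and inner products are linear in the first and conjugate-linear in the second variable; $a(u)=a(u,u)$; $\Sigma_\theta=\{re^{i\alpha}:r\ge0,\ |\alpha|\le\theta\}$. The form $a$ is accretive if $\operatorname{Re}a(u)\ge0$ for all $u\in D(a)$, and $j$-sectorial if there are $\gamma\in\mathbf{R}$ (a vertex) and $\theta\in[0,\frac\pi2)$ with $a(u)-\gamma\|j(u)\|_H^2\in\Sigma_\theta$ for all $u\in D(a)$; then $\|u\|_a=(\operatorname{Re}a(u)+(1-\gamma)\|j(u)\|_H^2)^{1/2}$ is a seminorm on $D(a)$. The operator $A$ associated with $(a,j)$ is the (well-defined) operator in $H$ such that $x\in D(A)$ and $Ax=f$ if and only if there is a Cauchy sequence $(u_n)$ in $(D(a),\|\cdot\|_a)$ with $\lim j(u_n)=x$ in $H$ and $\lim a(u_n,v)=(f,j(v))_H$ for all $v\in D(a)$; it is $m$-sectorial, so $-A$ generates a (holomorphic) $C_0$-semigroup $S=(S_t)_{t>0}$. The orthogonal projection onto $C$ maps $x$ to the unique nearest point of $C$. *)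

theory Defs
  imports "HOL-Analysis.Analysis"
begin

class complex_vector = ab_group_add +
  fixes scaleC :: "complex \<Rightarrow> 'a \<Rightarrow> 'a"  (infixr "*\<^sub>C" 75)
  assumes scaleC_add_right: "c *\<^sub>C (x + y) = c *\<^sub>C x + c *\<^sub>C y"
    and scaleC_add_left: "(c + d) *\<^sub>C x = c *\<^sub>C x + d *\<^sub>C x"
    and scaleC_scaleC: "c *\<^sub>C d *\<^sub>C x = (c * d) *\<^sub>C x"
    and scaleC_one: "1 *\<^sub>C x = x"

text \<open>A complex inner product space is a real inner product space under the real part of its
  complex inner product.  Building on \<^class>\<open>real_inner\<close> makes the norm, topology and convexity of
  the library available; positive definiteness is inherited from there.  The complex inner
  product is linear in the first argument.\<close>

class complex_inner = complex_vector + real_inner +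
  fixes cinner :: "'a \<Rightarrow> 'a \<Rightarrow> complex"
  assumes scaleR_scaleC: "r *\<^sub>R x = complex_of_real r *\<^sub>C x"
    and cinner_add_left: "cinner (x + y) z = cinner x z + cinner y z"
    and cinner_scaleC_left: "cinner (c *\<^sub>C x) y = c * cinner x y"
    and cinner_commute: "cinner y x = cnj (cinner x y)"
    and inner_eq_Re_cinner: "inner x y = Re (cinner x y)"

class chilbert_space = complex_inner + complete_space

definition clinear :: "('a::complex_vector \<Rightarrow> 'b::complex_vector) \<Rightarrow> bool" where
  "clinear f \<longleftrightarrow> (\<forall>x y. f (x + y) = f x + f y) \<and> (\<forall>c x. f (c *\<^sub>C x) = c *\<^sub>C f x)"

definition sesquilinear :: "('d::complex_vector \<Rightarrow> 'd \<Rightarrow> complex) \<Rightarrow> bool" where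
  "sesquilinear a \<longleftrightarrow>
     (\<forall>u u' v. a (u + u') v = a u v + a u' v) \<and>
     (\<forall>c u v. a (c *\<^sub>C u) v = c * a u v) \<and>
     (\<forall>u v v'. a u (v + v') = a u v + a u v') \<and>
     (\<forall>c u v. a u (c *\<^sub>C v) = cnj c * a u v)"

definition sector :: "real \<Rightarrow> complex set" where
  "sector \<theta> = {rcis r \<alpha> | r \<alpha>. r \<ge> 0 \<and> \<bar>\<alpha>\<bar> \<le> \<theta>}"

definition accretive :: "('d \<Rightarrow> 'd \<Rightarrow> complex) \<Rightarrow> bool" where
  "accretive a \<longleftrightarrow> (\<forall>u. Re (a u u) \<ge> 0)"

text \<open>The vertex \<open>\<gamma>\<close> is kept as a parameter, since the seminorm below depends on it.\<close>

definition j_sectorial ::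
  "('d \<Rightarrow> 'd \<Rightarrow> complex) \<Rightarrow> ('d \<Rightarrow> 'h::complex_inner) \<Rightarrow> real \<Rightarrow> bool" where
  "j_sectorial a j \<gamma> \<longleftrightarrow>
     (\<exists>\<theta>. 0 \<le> \<theta> \<and> \<theta> < pi / 2 \<and>
        (\<forall>u. a u u - complex_of_real (\<gamma> * (norm (j u))\<^sup>2) \<in> sector \<theta>))"

definition form_norm ::
  "('d \<Rightarrow> 'd \<Rightarrow> complex) \<Rightarrow> ('d \<Rightarrow> 'h::complex_inner) \<Rightarrow> real \<Rightarrow> 'd \<Rightarrow> real" where
  "form_norm a j \<gamma> u = sqrt (Re (a u u) + (1 - \<gamma>) * (norm (j u))\<^sup>2)"

definition form_Cauchy ::
  "('d::complex_vector \<Rightarrow> 'd \<Rightarrow> complex) \<Rightarrow> ('d \<Rightarrow> 'h::complex_inner) \<Rightarrow> real \<Rightarrow> (nat \<Rightarrow> 'd) \<Rightarrow> bool"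
where
  "form_Cauchy a j \<gamma> u \<longleftrightarrow>
     (\<forall>e>0. \<exists>N. \<forall>m\<ge>N. \<forall>n\<ge>N. form_norm a j \<gamma> (u m - u n) < e)"

definition form_bounded ::
  "('d \<Rightarrow> 'd \<Rightarrow> complex) \<Rightarrow> ('d \<Rightarrow> 'h::complex_inner) \<Rightarrow> real \<Rightarrow> (nat \<Rightarrow> 'd) \<Rightarrow> bool" where
  "form_bounded a j \<gamma> u \<longleftrightarrow> (\<exists>B. \<forall>n. form_norm a j \<gamma> (u n) \<le> B)"

text \<open>Unbounded operators are represented by their graphs.\<close>

definition associated_operator ::
  "('d::complex_vector \<Rightarrow> 'd \<Rightarrow> complex) \<Rightarrow> ('d \<Rightarrow> 'h::complex_inner) \<Rightarrow> real \<Rightarrow> ('h \<times> 'h) set"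
where
  "associated_operator a j \<gamma> =
     {(x, f). \<exists>u. form_Cauchy a j \<gamma> u \<and> (\<lambda>n. j (u n)) \<longlonglongrightarrow> x \<and>
                 (\<forall>v. (\<lambda>n. a (u n) v) \<longlonglongrightarrow> cinner f (j v))}"

definition neg_operator :: "('h::complex_inner \<times> 'h) set \<Rightarrow> ('h \<times> 'h) set" where
  "neg_operator A = {(x, - f) | x f. (x, f) \<in> A}"

text \<open>Semigroups are indexed by \<open>t > 0\<close>; the values of \<open>S\<close> at \<open>t \<le> 0\<close> are irrelevant.\<close>

definition C0_semigroup :: "(real \<Rightarrow> 'h::complex_inner \<Rightarrow> 'h) \<Rightarrow> bool" where
  "C0_semigroup S \<longleftrightarrow>
     (\<forall>t>0. clinear (S t) \<and> bounded_linear (S t)) \<and>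
     (\<forall>s>0. \<forall>t>0. S (s + t) = S s \<circ> S t) \<and>
     (\<forall>x. ((\<lambda>t. S t x) \<longlongrightarrow> x) (at_right 0))"

definition generator :: "(real \<Rightarrow> 'h::complex_inner \<Rightarrow> 'h) \<Rightarrow> ('h \<times> 'h) set" where
  "generator S = {(x, y). ((\<lambda>t. (1 / t) *\<^sub>R (S t x - x)) \<longlongrightarrow> y) (at_right 0)}"

definition generates ::
  "('h::complex_inner \<times> 'h) set \<Rightarrow> (real \<Rightarrow> 'h \<Rightarrow> 'h) \<Rightarrow> bool" where
  "generates G S \<longleftrightarrow> C0_semigroup S \<and> generator S = G"

definition projection :: "'h::chilbert_space set \<Rightarrow> 'h \<Rightarrow> 'h" where
  "projection C x = (THE y. y \<in> C \<and> (\<forall>z\<in>C. dist x y \<le> dist x z))"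

end

theory Submission
  imports Defs
begin

text \<open>All three conditions are equivalent to the existence, for every \<open>u\<close> and \<open>\<epsilon> > 0\<close>, of a
  \<open>w\<close> with \<open>\<parallel>j w - P j u\<parallel> \<le> \<epsilon>\<close> and \<open>Re a(w, u - w) \<ge> -\<epsilon>\<close>.  Such \<open>w\<close> are automatically bounded in
  the form norm, and for fixed \<open>\<epsilon>\<close> they form a convex set because \<open>w \<mapsto> Re a(w, u - w)\<close> is concave;
  almost minimal elements of these nested sets form a Cauchy sequence by the parallelogram law,
  which avoids passing to the completion of \<open>D(a)\<close>.

  If \<open>S\<close> leaves \<open>C\<close> invariant then so does \<open>\<mu>(\<mu> + A)\<^sup>-\<^sup>1\<close>, and the approximants of
  \<open>\<mu>(\<mu> + A)\<^sup>-\<^sup>1 P j u\<close> for large \<open>\<mu>\<close> are the required \<open>w\<close>.  Conversely, applying the condition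
  along a Cauchy sequence representing \<open>y \<in> D(A)\<close> yields \<open>Re (Ay, y - Py) \<ge> 0\<close>, so the distance to
  \<open>C\<close> has a nonpositive right Dini derivative along orbits starting in \<open>D(A)\<close>.\<close>

section \<open>Semidefinite forms without completeness\<close>

lemma scaleC_minus1: "- (x::'a::complex_vector) = complex_of_real (-1) *\<^sub>C x"
proof -
  have "x + complex_of_real (-1) *\<^sub>C x = (1 + complex_of_real (-1)) *\<^sub>C x"
    by (simp only: scaleC_add_left scaleC_one)
  moreover have "(0::complex) *\<^sub>C x = 0" using scaleC_add_left[of 0 0 x] by simp
  ultimately have "x + complex_of_real (-1) *\<^sub>C x = 0" by simp
  then show ?thesis by (rule minus_unique)
qed

text \<open>The domain carries only complex scalars, so real homogeneity is phrased with embedded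
  reals. This lets the two parts of \<open>Re a\<close> be treated as real bilinear forms.\<close>

definition real_functional :: "('d::complex_vector \<Rightarrow> real) \<Rightarrow> bool" where
  "real_functional F \<longleftrightarrow> (\<forall>u v. F (u + v) = F u + F v) \<and> (\<forall>r u. F (complex_of_real r *\<^sub>C u) = r * F u)"

lemma real_functionalD:
  assumes "real_functional F"
  shows "F (u + v) = F u + F v" "F (complex_of_real r *\<^sub>C u) = r * F u"
    "F (u - v) = F u - F v" "F (- u) = - F u" "F 0 = 0"
proof -
  show add: "F (u + v) = F u + F v" for u v using assms by (simp add: real_functional_def)
  show scale: "F (complex_of_real r *\<^sub>C u) = r * F u" for r u using assms by (simp add: real_functional_def)
  show neg: "F (- u) = - F u" for u
    using scale[of "-1" u] by (simp only: scaleC_minus1)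
  show "F (u - v) = F u - F v" using add[of u "-v"] neg[of v] by simp
  show "F 0 = 0" using add[of 0 0] by simp
qed

text \<open>For \<open>q = 0\<close> an affine function bounded below has slope zero; otherwise
  evaluate at the minimiser \<open>- D / q\<close>. Cauchy-Schwarz, the approximate Riesz lemma and
  the bound on \<open>skew\<close> all rest on this.\<close>

lemma quadratic_nonneg_imp_discriminant:
  fixes q D \<delta> :: real
  assumes "\<And>t. 0 \<le> q * t\<^sup>2 + 2 * D * t + \<delta>" "0 \<le> q"
  shows "D\<^sup>2 \<le> q * \<delta>"
proof (cases "q = 0")
  case True
  have "D = 0"
  proof (rule ccontr)
    assume "D \<noteq> 0"
    \<comment> \<open>At this point the affine function takes the value -1.\<close>
    then show False using assms(1)[of "- (\<delta> + 1) / (2 * D)"] True by simp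
  qed
  then show ?thesis using True by simp
next
  case False
  then have "q > 0" using assms by simp
  have "0 \<le> q * (- D / q)\<^sup>2 + 2 * D * (- D / q) + \<delta>" by (rule assms(1))
  also have "\<dots> = \<delta> - D\<^sup>2 / q" using \<open>q > 0\<close> by (simp add: power2_eq_square field_simps)
  finally show ?thesis using \<open>q > 0\<close> by (simp add: field_simps)
qed

text \<open>A kernel is allowed, since the form norm is only a seminorm.\<close>

locale psd_form =
  fixes h :: "'d::complex_vector \<Rightarrow> 'd \<Rightarrow> real"
  assumes lin: "real_functional (h u)"
    and sym: "h u v = h v u"
    and nonneg: "0 \<le> h u u"
begin

definition N :: "'d \<Rightarrow> real" where "N u = sqrt (h u u)"

lemma h_simps:
  "h (u + v) w = h u w + h v w" "h w (u + v) = h w u + h w v"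
  "h (u - v) w = h u w - h v w" "h w (u - v) = h w u - h w v"
  "h (complex_of_real r *\<^sub>C u) w = r * h u w" "h w (complex_of_real r *\<^sub>C u) = r * h w u"
  using real_functionalD[OF lin] by (simp_all add: sym[of _ w])

lemma N_nonneg [simp]: "0 \<le> N u" by (simp add: N_def nonneg)

lemma N_sq: "(N u)\<^sup>2 = h u u" by (simp add: N_def nonneg)

lemma Cauchy_Schwarz_sq: "(h u v)\<^sup>2 \<le> h u u * h v v"
proof (rule quadratic_nonneg_imp_discriminant)
  fix t
  have "0 \<le> h (complex_of_real t *\<^sub>C u + v) (complex_of_real t *\<^sub>C u + v)" by (rule nonneg)
  then show "0 \<le> h u u * t\<^sup>2 + 2 * h u v * t + h v v"
    by (simp add: h_simps sym[of v u] power2_eq_square algebra_simps)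
qed (rule nonneg)

lemma Cauchy_Schwarz: "\<bar>h u v\<bar> \<le> N u * N v"
  using real_sqrt_le_mono[OF Cauchy_Schwarz_sq[of u v]] by (simp add: N_def real_sqrt_mult)

lemma N_triangle: "N (u + v) \<le> N u + N v"
proof (rule power2_le_imp_le)
  show "(N (u + v))\<^sup>2 \<le> (N u + N v)\<^sup>2"
    using Cauchy_Schwarz[of u v] by (simp add: power2_sum N_sq h_simps sym[of v u])
qed simp

lemma N_scale: "N (complex_of_real r *\<^sub>C u) = \<bar>r\<bar> * N u"
  by (simp add: N_def h_simps real_sqrt_mult mult.assoc[symmetric])

lemma N_minus: "N (- u) = N u"
  using N_scale[of "-1" u] by (simp only: scaleC_minus1 abs_minus_cancel abs_one mult_1)

lemma N_diff: "N (u - v) \<le> N u + N v"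
  using N_triangle[of u "-v"] by (simp add: N_minus)

lemma parallelogram_midpoint:
  "(N (u - v))\<^sup>2 = 2 * (N u)\<^sup>2 + 2 * (N v)\<^sup>2 - 4 * (N (complex_of_real (1/2) *\<^sub>C (u + v)))\<^sup>2"
  by (simp add: N_sq h_simps sym[of v u] del: of_real_divide) (simp add: field_simps)

definition N_Cauchy :: "(nat \<Rightarrow> 'd) \<Rightarrow> bool" where
  "N_Cauchy u \<longleftrightarrow> (\<forall>e>0. \<exists>M. \<forall>m\<ge>M. \<forall>n\<ge>M. N (u m - u n) < e)"

text \<open>Elements of almost minimal seminorm form a Cauchy sequence; this replaces weak compactness
  and Mazur's lemma in the incomplete space.\<close>
lemma nested_midpoint_convex_Cauchy:
  assumes anti: "\<And>m n. m \<le> n \<Longrightarrow> D n \<subseteq> D m"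
    and mid: "\<And>n u v. u \<in> D n \<Longrightarrow> v \<in> D n \<Longrightarrow> complex_of_real (1/2) *\<^sub>C (u + v) \<in> D n"
    and bdd: "\<And>n. \<exists>w\<in>D n. N w \<le> B"
  obtains x where "\<And>n. x n \<in> D n" "N_Cauchy x"
proof -
  \<comment> \<open>The sets shrink, so these infima increase; being bounded by
    \<open>B\<^sup>2\<close> they converge.\<close>
  define d where "d n = (INF w\<in>D n. (N w)\<^sup>2)" for n
  have bb: "bdd_below ((\<lambda>w. (N w)\<^sup>2) ` D n)" for n by (rule bdd_belowI[of _ 0]) auto
  have ne: "D n \<noteq> {}" for n using bdd[of n] by auto
  have d_le: "d n \<le> (N w)\<^sup>2" if "w \<in> D n" for w n
    unfolding d_def by (rule cINF_lower[OF bb that])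
  have d_B: "d n \<le> B\<^sup>2" for n
  proof -
    obtain w where "w \<in> D n" "N w \<le> B" using bdd by blast
    then show ?thesis using d_le[of w n] power_mono[of "N w" B 2] by simp
  qed
  have d_mono: "incseq d"
    unfolding incseq_def d_def using anti by (auto intro!: cINF_superset_mono ne bb)
  obtain L where L: "d \<longlonglongrightarrow> L" "\<And>n. d n \<le> L"
    using incseq_convergent[OF d_mono, of "B\<^sup>2"] d_B by blast
  define \<epsilon> where "\<epsilon> = (\<lambda>n. 1 / real (Suc n))"
  have \<epsilon>: "\<epsilon> \<longlonglongrightarrow> 0" "\<And>n. 0 < \<epsilon> n" "\<And>m n. m \<le> n \<Longrightarrow> \<epsilon> n \<le> \<epsilon> m"
    using LIMSEQ_Suc[OF lim_1_over_n[where 'a = real]] by (auto simp: \<epsilon>_def field_simps)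
  have "\<exists>w\<in>D n. (N w)\<^sup>2 < d n + \<epsilon> n" for n
  proof -
    have "(INF w\<in>D n. (N w)\<^sup>2) < d n + \<epsilon> n" using \<epsilon>(2) by (simp add: d_def)
    then show ?thesis using cINF_less_iff[OF ne bb] by blast
  qed
  then obtain x where x: "\<And>n. x n \<in> D n" "\<And>n. (N (x n))\<^sup>2 < d n + \<epsilon> n"
    by metis
  have "N_Cauchy x" unfolding N_Cauchy_def
  proof (intro allI impI)
    fix e :: real assume "e > 0"
    \<comment> \<open>Beyond index \<open>M\<close> both points have squared seminorm at most
      \<open>L + \<epsilon> M\<close> and their midpoint at least \<open>d M\<close>, so the
      parallelogram law bounds the squared distance by this expression.\<close>
    have "(\<lambda>M. 4 * (L - d M) + 4 * \<epsilon> M) \<longlonglongrightarrow> 4 * (L - L) + 4 * 0"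
      by (intro tendsto_intros L \<epsilon>)
    then have "\<forall>\<^sub>F M in sequentially. 4 * (L - d M) + 4 * \<epsilon> M < e\<^sup>2"
      by (rule order_tendstoD) (use \<open>e > 0\<close> in simp)
    then obtain M where M: "4 * (L - d M) + 4 * \<epsilon> M < e\<^sup>2"
      by (auto simp: eventually_sequentially)
    show "\<exists>M. \<forall>m\<ge>M. \<forall>n\<ge>M. N (x m - x n) < e"
    proof (intro exI[of _ M] allI impI)
      fix m n assume mn: "m \<ge> M" "n \<ge> M"
      have "x m \<in> D M" "x n \<in> D M" using x(1) anti mn by blast+
      then have "d M \<le> (N (complex_of_real (1/2) *\<^sub>C (x m + x n)))\<^sup>2"
        by (intro d_le mid)
      then have *: "(N (x m - x n))\<^sup>2 \<le> 2 * (N (x m))\<^sup>2 + 2 * (N (x n))\<^sup>2 - 4 * d M"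
        unfolding parallelogram_midpoint by simp
      moreover have "\<epsilon> m \<le> \<epsilon> M" "\<epsilon> n \<le> \<epsilon> M"
        using mn by (auto intro: \<epsilon>)
      ultimately have "2 * (N (x m))\<^sup>2 + 2 * (N (x n))\<^sup>2 \<le> 4 * L + 4 * \<epsilon> M"
        using x(2)[of m] x(2)[of n] L(2)[of m] L(2)[of n]
        by argo
      then have "(N (x m - x n))\<^sup>2 < e\<^sup>2"
        using * M by argo
      then show "N (x m - x n) < e" using \<open>e > 0\<close> by (simp add: power_less_imp_less_base)
    qed
  qed
  then show thesis using that x(1) by blast
qed

text \<open>An exact minimiser of \<open>J\<close> would represent \<open>G\<close>. Without
  completeness there are only almost minimisers, and being within \<open>e\<^sup>2\<close> of the
  infimum limits the first variation to \<open>e\<close> by the discriminant lemma.\<close>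

lemma approximate_Riesz:
  assumes G: "real_functional G" "\<And>v. \<bar>G v\<bar> \<le> K * N v" and "e > 0"
  obtains r where "\<And>v. \<bar>h r v - G v\<bar> \<le> e * N v"
proof -
  define J where "J v = h v v - 2 * G v" for v
  have "J v \<ge> - K\<^sup>2" for v
  proof -
    have "0 \<le> (N v - K)\<^sup>2" by simp
    then show ?thesis using G(2)[of v] by (simp add: J_def power2_diff N_sq mult.commute)
  qed
  then have bb: "bdd_below (range J)" by (intro bdd_belowI[of _ "- K\<^sup>2"]) auto
  have "Inf (range J) < Inf (range J) + e\<^sup>2" using \<open>e > 0\<close> by simp
  then obtain r where r: "J r < Inf (range J) + e\<^sup>2"
    using cInf_less_iff[OF _ bb] by blast
  have "\<bar>h r v - G v\<bar> \<le> e * N v" for v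
  proof -
    have "(h r v - G v)\<^sup>2 \<le> h v v * e\<^sup>2"
    proof (rule quadratic_nonneg_imp_discriminant)
      fix t
      \<comment> \<open>Moving from \<open>r\<close> by \<open>t\<close> times \<open>v\<close>
        lowers \<open>J\<close> by at most \<open>e\<^sup>2\<close>, which is a nonnegative
        quadratic polynomial in \<open>t\<close>.\<close>
      have "J r - e\<^sup>2 \<le> J (r + complex_of_real t *\<^sub>C v)"
        using r cInf_lower[OF _ bb] by (smt (verit) rangeI)
      then show "0 \<le> h v v * t\<^sup>2 + 2 * (h r v - G v) * t + e\<^sup>2"
        by (simp add: J_def h_simps real_functionalD[OF G(1)] sym[of v r] power2_eq_square algebra_simps)
    qed (rule nonneg)
    also have "\<dots> = (e * N v)\<^sup>2" by (simp add: power_mult_distrib N_sq)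
    finally show ?thesis using \<open>e > 0\<close> by (simp add: abs_le_square_iff[symmetric] abs_mult)
  qed
  then show thesis by (rule that)
qed

end

section \<open>An approximate Lax-Milgram theorem for symmetric plus antisymmetric forms\<close>

locale sectorial_pair = psd_form h for h :: "'d::complex_vector \<Rightarrow> 'd \<Rightarrow> real" +
  fixes s :: "'d \<Rightarrow> 'd \<Rightarrow> real" and M :: real
  assumes s_lin: "real_functional (s u)"
    and s_antisym: "s u v = - s v u"
    and s_bound: "\<bar>s u v\<bar> \<le> M * N u * N v"
    and M_nonneg: "0 \<le> M"
begin

lemma s_self [simp]: "s u u = 0" using s_antisym[of u u] by simp

lemma s_simps:
  "s (u + v) w = s u w + s v w" "s w (u + v) = s w u + s w v"
  "s (u - v) w = s u w - s v w" "s w (u - v) = s w u - s w v"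
  "s (complex_of_real r *\<^sub>C u) w = r * s u w" "s w (complex_of_real r *\<^sub>C u) = r * s w u"
  using real_functionalD[OF s_lin] by (simp_all add: s_antisym[of _ w])

text \<open>The antisymmetric part only sees the component of \<open>v\<close> orthogonal to \<open>r\<close>, so the two
  contributions add up in a Pythagorean way.\<close>
lemma skew_perturbation_bound:
  "\<bar>\<alpha> * h r v + \<beta> * s r v\<bar> \<le> sqrt (\<alpha>\<^sup>2 + \<beta>\<^sup>2 * M\<^sup>2) * N r * N v"
proof (cases "h r r = 0")
  case True
  then have "N r = 0" by (simp add: N_def)
  then show ?thesis using Cauchy_Schwarz[of r v] s_bound[of r v] by simp
next
  case False
  define H where "H = h r r"
  have "H > 0" using False nonneg[of r] by (simp add: H_def)
  define X where "X = h r v"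
  \<comment> \<open>Component of \<open>v\<close> orthogonal to \<open>r\<close>; replacing
    \<open>v\<close> by it leaves \<open>s r v\<close> unchanged because
    \<open>s r r = 0\<close>.\<close>
  define v' where "v' = v - complex_of_real (X / H) *\<^sub>C r"
  have hv': "h v' v' = h v v - X\<^sup>2 / H"
    using \<open>H > 0\<close> by (simp add: v'_def h_simps H_def[symmetric] X_def[symmetric] sym[of v r]
        power2_eq_square del: of_real_divide)
  have sv': "s r v = s r v'" by (simp add: v'_def s_simps del: of_real_divide)
  have sY: "\<bar>s r v\<bar> \<le> M * (N r * N v')" using s_bound[of r v'] sv' by (simp add: mult.assoc)
  define Z where "Z = N r * N v'"
  have "Z \<ge> 0" by (simp add: Z_def)
  have Z2: "X\<^sup>2 + Z\<^sup>2 = (N r * N v)\<^sup>2"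
    using \<open>H > 0\<close> by (simp add: Z_def power_mult_distrib N_sq hv' H_def[symmetric] field_simps)
  have "\<bar>\<alpha> * X + \<beta> * s r v\<bar> \<le> \<bar>\<alpha>\<bar> * \<bar>X\<bar> + (\<bar>\<beta>\<bar> * M) * Z"
  proof -
    have "\<bar>\<beta> * s r v\<bar> \<le> \<bar>\<beta>\<bar> * (M * Z)"
      unfolding abs_mult using sY by (intro mult_left_mono) (auto simp: Z_def)
    then show ?thesis using abs_triangle_ineq[of "\<alpha> * X" "\<beta> * s r v"] by (simp add: abs_mult)
  qed
  also have "\<dots> \<le> sqrt (\<alpha>\<^sup>2 + \<beta>\<^sup>2 * M\<^sup>2) * (N r * N v)"
  proof (rule power2_le_imp_le)
    \<comment> \<open>Cauchy-Schwarz in the plane for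
      \<open>(\<bar>\<alpha>\<bar>, \<bar>\<beta>\<bar> * M)\<close> and
      \<open>(\<bar>X\<bar>, Z)\<close>.\<close>
    have "0 \<le> (\<bar>\<alpha>\<bar> * Z - \<bar>\<beta>\<bar> * M * \<bar>X\<bar>)\<^sup>2" by simp
    then have "(\<bar>\<alpha>\<bar> * \<bar>X\<bar> + (\<bar>\<beta>\<bar> * M) * Z)\<^sup>2 \<le> (\<alpha>\<^sup>2 + \<beta>\<^sup>2 * M\<^sup>2) * (X\<^sup>2 + Z\<^sup>2)"
      by (simp add: power2_sum power2_diff power_mult_distrib algebra_simps)
    then show "(\<bar>\<alpha>\<bar> * \<bar>X\<bar> + (\<bar>\<beta>\<bar> * M) * Z)\<^sup>2 \<le> (sqrt (\<alpha>\<^sup>2 + \<beta>\<^sup>2 * M\<^sup>2) * (N r * N v))\<^sup>2"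
      by (simp add: Z2 power_mult_distrib)
  qed simp
  finally show ?thesis by (simp add: X_def mult.assoc)
qed

text \<open>Damped fixed-point iteration: represent the current residual approximately by some
  \<open>r\<close> and add \<open>\<tau>\<close> times \<open>r\<close> to \<open>u\<close>. The new
  residual is \<open>(1 - \<tau>) * h r v - \<tau> * s r v\<close> up to the Riesz error, and
  \<open>skew_perturbation_bound\<close> makes this a contraction.\<close>

lemma approximate_Lax_Milgram:
  assumes F: "real_functional F" "\<And>v. \<bar>F v\<bar> \<le> K * N v" and "e > 0"
  obtains u where "\<And>v. \<bar>F v - (h u v + s u v)\<bar> \<le> e * N v"
proof -
  \<comment> \<open>This value minimises
    \<open>(1 - \<tau>)\<^sup>2 + \<tau>\<^sup>2 * M\<^sup>2\<close>; the minimum is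
    \<open>M\<^sup>2 / (1 + M\<^sup>2)\<close>, so \<open>q\<close> is below 1.\<close>
  define \<tau> where "\<tau> = 1 / (1 + M\<^sup>2)"
  define q where "q = sqrt ((1 - \<tau>)\<^sup>2 + (-\<tau>)\<^sup>2 * M\<^sup>2)"
  have pos: "1 + M\<^sup>2 > 0" by (simp add: add_pos_nonneg)
  have "(1 - \<tau>)\<^sup>2 + (-\<tau>)\<^sup>2 * M\<^sup>2 = M\<^sup>2 / (1 + M\<^sup>2)"
  proof -
    have eq: "1 - \<tau> = M\<^sup>2 * \<tau>" using pos by (simp add: \<tau>_def field_simps)
    have "(1 - \<tau>)\<^sup>2 + (-\<tau>)\<^sup>2 * M\<^sup>2 = M\<^sup>2 * \<tau> * (\<tau> * (1 + M\<^sup>2))"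
      unfolding eq by (simp add: power2_eq_square algebra_simps)
    also have "\<tau> * (1 + M\<^sup>2) = 1" using pos by (simp add: \<tau>_def)
    finally show ?thesis by (simp add: \<tau>_def)
  qed
  then have q: "0 \<le> q" "q < 1" using pos by (simp_all add: q_def)
  \<comment> \<open>Relative tolerance of the Riesz step, chosen so that the total contraction
    factor \<open>\<kappa> + q * (1 + \<kappa>)\<close> equals \<open>(1 + q) / 2\<close>.\<close>
  define \<kappa> where "\<kappa> = (1 - q) / (2 * (1 + q))"
  have "\<kappa> * (1 + q) = (1 - q) / 2" using q by (simp add: \<kappa>_def divide_simps)
  then have \<kappa>: "\<kappa> > 0" "\<kappa> + q * (1 + \<kappa>) = (1 + q) / 2"
    using q by (simp add: \<kappa>_def, simp add: algebra_simps)
  have step: "\<exists>u'. \<forall>v. \<bar>F v - (h u' v + s u' v)\<bar> \<le> ((1 + q) / 2 * \<rho>) * N v"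
    if u: "\<forall>v. \<bar>F v - (h u v + s u v)\<bar> \<le> \<rho> * N v" and "\<rho> > 0" for u \<rho>
  proof -
    define G where "G v = F v - (h u v + s u v)" for v
    have "real_functional G" unfolding G_def real_functional_def
      by (simp add: real_functionalD[OF F(1)] h_simps s_simps algebra_simps)
    moreover have "\<bar>G v\<bar> \<le> \<rho> * N v" for v using u by (simp add: G_def)
    moreover have "\<kappa> * \<rho> > 0" using \<kappa> \<open>\<rho> > 0\<close> by simp
    ultimately obtain r where r: "\<And>v. \<bar>h r v - G v\<bar> \<le> \<kappa> * \<rho> * N v"
      using approximate_Riesz by blast
    \<comment> \<open>Testing the Riesz estimate with \<open>v = r\<close> bounds the size of the
      correction.\<close>
    have "(N r)\<^sup>2 \<le> (1 + \<kappa>) * \<rho> * N r"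
      using r[of r] u[rule_format, of r] by (simp add: N_sq G_def algebra_simps)
    then have Nr: "N r \<le> (1 + \<kappa>) * \<rho>"
      using N_nonneg[of r] \<kappa>(1) \<open>\<rho> > 0\<close>
      by (cases "N r = 0") (auto simp: power2_eq_square)
    have "\<bar>F v - (h (u + complex_of_real \<tau> *\<^sub>C r) v + s (u + complex_of_real \<tau> *\<^sub>C r) v)\<bar>
        \<le> ((1 + q) / 2 * \<rho>) * N v" for v
    proof -
      have eq: "F v - (h (u + complex_of_real \<tau> *\<^sub>C r) v + s (u + complex_of_real \<tau> *\<^sub>C r) v)
        = - (h r v - G v) + ((1 - \<tau>) * h r v + (-\<tau>) * s r v)"
        by (simp add: G_def h_simps s_simps algebra_simps)
      have "\<bar>(1 - \<tau>) * h r v + (-\<tau>) * s r v\<bar> \<le> q * N r * N v"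
        using skew_perturbation_bound[of "1 - \<tau>" r v "-\<tau>"] by (simp only: q_def)
      also have "\<dots> \<le> q * ((1 + \<kappa>) * \<rho>) * N v"
        using Nr q by (intro mult_right_mono mult_left_mono) auto
      finally have "\<bar>F v - (h (u + complex_of_real \<tau> *\<^sub>C r) v + s (u + complex_of_real \<tau> *\<^sub>C r) v)\<bar>
        \<le> \<kappa> * \<rho> * N v + q * ((1 + \<kappa>) * \<rho>) * N v"
        unfolding eq using r[of v] by linarith
      also have "\<dots> = (\<kappa> + q * (1 + \<kappa>)) * \<rho> * N v" by (simp add: algebra_simps)
      finally show ?thesis by (simp only: \<kappa>(2))
    qed
    then show ?thesis by blast
  qed
  \<comment> \<open>The iteration starts at \<open>u = 0\<close> with residual bound
    \<open>K\<close>; the maximum keeps the bound positive, as \<open>step\<close> demands.\<close>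
  define K' where "K' = max K 1"
  have "K' > 0" by (simp add: K'_def)
  have it: "\<exists>u. \<forall>v. \<bar>F v - (h u v + s u v)\<bar> \<le> (((1 + q) / 2) ^ n * K') * N v" for n
  proof (induction n)
    case 0
    have "h 0 v = 0" "s 0 v = 0" for v using real_functionalD(5)[OF lin, of v] real_functionalD(5)[OF s_lin, of v]
      by (simp_all add: sym[of 0] s_antisym[of 0])
    moreover have "K * N v \<le> K' * N v" for v
      unfolding K'_def by (intro mult_right_mono) auto
    ultimately show ?case using F(2) by (intro exI[of _ 0]) (simp, blast intro: order_trans)
  next
    case (Suc n)
    then obtain u where "\<forall>v. \<bar>F v - (h u v + s u v)\<bar> \<le> (((1 + q) / 2) ^ n * K') * N v" ..
    from step[OF this] show ?case using q \<open>K' > 0\<close> by (simp add: mult.assoc)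
  qed
  have "(\<lambda>n. ((1 + q) / 2) ^ n * K') \<longlonglongrightarrow> 0 * K'"
    using q by (intro tendsto_intros LIMSEQ_realpow_zero) auto
  then have "\<forall>\<^sub>F n in sequentially. ((1 + q) / 2) ^ n * K' < e"
    by (rule order_tendstoD) (use \<open>e > 0\<close> in simp)
  then obtain n where n: "((1 + q) / 2) ^ n * K' < e" by (auto simp: eventually_sequentially)
  obtain u where u: "\<And>v. \<bar>F v - (h u v + s u v)\<bar> \<le> (((1 + q) / 2) ^ n * K') * N v"
    using it by blast
  have "\<bar>F v - (h u v + s u v)\<bar> \<le> e * N v" for v
    using u[of v] mult_right_mono[OF less_imp_le[OF n] N_nonneg[of v]] by linarith
  then show thesis by (rule that)
qed

text \<open>Take approximate solutions with error \<open>1 / Suc n\<close>. Since \<open>s\<close>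
  vanishes on the diagonal, testing the difference of two of them with itself gives its squared
  seminorm, so the sequence is Cauchy.\<close>

lemma Lax_Milgram_Cauchy:
  assumes F: "real_functional F" "\<And>v. \<bar>F v\<bar> \<le> K * N v"
  obtains u where "N_Cauchy u" "\<And>v. (\<lambda>n. h (u n) v + s (u n) v) \<longlonglongrightarrow> F v"
proof -
  have "\<exists>u. \<forall>v. \<bar>F v - (h u v + s u v)\<bar> \<le> (1 / real (Suc n)) * N v" for n
    using approximate_Lax_Milgram[OF F, of "1 / real (Suc n)"] by (metis of_nat_0_less_iff zero_less_Suc zero_less_divide_1_iff)
  then obtain u where u: "\<And>n v. \<bar>F v - (h (u n) v + s (u n) v)\<bar> \<le> (1 / real (Suc n)) * N v"
    by metis
  have lim: "(\<lambda>n. h (u n) v + s (u n) v) \<longlonglongrightarrow> F v" for v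
  proof (rule LIM_zero_cancel, rule Lim_null_comparison)
    show "\<forall>\<^sub>F n in sequentially. norm (h (u n) v + s (u n) v - F v) \<le> 1 / real (Suc n) * N v"
      using u[of v] by (simp add: abs_minus_commute)
    have "(\<lambda>n. 1 / real (Suc n) * N v) \<longlonglongrightarrow> 0 * N v"
      by (intro tendsto_intros LIMSEQ_Suc lim_1_over_n)
    then show "(\<lambda>n. 1 / real (Suc n) * N v) \<longlonglongrightarrow> 0" by simp
  qed
  have dist: "N (u m - u n) \<le> 1 / real (Suc m) + 1 / real (Suc n)" for m n
  proof -
    let ?w = "u m - u n"
    have "(N ?w)\<^sup>2 = (h (u m) ?w + s (u m) ?w) - (h (u n) ?w + s (u n) ?w)"
      using s_self[of ?w] unfolding N_sq h_simps(3) s_simps(3) by linarith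
    then have "N ?w * N ?w \<le> (1 / real (Suc m) + 1 / real (Suc n)) * N ?w"
      using u[of ?w m] u[of ?w n] unfolding power2_eq_square distrib_right by linarith
    then show ?thesis using N_nonneg[of ?w]
      by (cases "N ?w = 0") (auto simp del: of_nat_Suc)
  qed
  have "N_Cauchy u" unfolding N_Cauchy_def
  proof (intro allI impI)
    fix e :: real assume "e > 0"
    then obtain M where M: "1 / real (Suc M) < e / 2"
      using reals_Archimedean[of "e / 2"] by (auto simp: inverse_eq_divide)
    show "\<exists>M. \<forall>m\<ge>M. \<forall>n\<ge>M. N (u m - u n) < e"
    proof (intro exI[of _ M] allI impI)
      fix m n assume "m \<ge> M" "n \<ge> M"
      then have "1 / real (Suc m) \<le> 1 / real (Suc M)" "1 / real (Suc n) \<le> 1 / real (Suc M)"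
        by (auto simp: field_simps)
      then show "N (u m - u n) < e" using dist[of m n] M by linarith
    qed
  qed
  then show thesis using lim that by blast
qed

end

section \<open>Sectorial forms and the associated operator\<close>

lemma sectorD:
  assumes "z \<in> sector \<theta>" "0 \<le> \<theta>" "\<theta> < pi / 2"
  shows "0 \<le> Re z" "\<bar>Im z\<bar> \<le> tan \<theta> * Re z"
proof -
  obtain r \<alpha> where z: "z = rcis r \<alpha>" "r \<ge> 0" "\<bar>\<alpha>\<bar> \<le> \<theta>"
    using assms(1) by (auto simp: sector_def)
  have cos: "cos \<alpha> > 0" using z assms by (intro cos_gt_zero_pi) auto
  then show "0 \<le> Re z" using z by simp
  have "tan \<bar>\<alpha>\<bar> \<le> tan \<theta>"
    using z assms by (intro tan_mono_le) auto
  moreover have "0 \<le> sin \<bar>\<alpha>\<bar>" using z(3) assms by (intro sin_ge_zero) auto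
  then have "tan \<bar>\<alpha>\<bar> = \<bar>sin \<alpha>\<bar> / cos \<alpha>"
    by (cases "\<alpha> \<ge> 0") (auto simp: tan_def)
  ultimately have "\<bar>sin \<alpha>\<bar> \<le> tan \<theta> * cos \<alpha>" using cos by (simp add: field_simps)
  then show "\<bar>Im z\<bar> \<le> tan \<theta> * Re z"
    using z mult_left_mono[of "\<bar>sin \<alpha>\<bar>" "tan \<theta> * cos \<alpha>" r] by (simp add: abs_mult mult_ac)
qed

locale sectorial_form =
  fixes a :: "'d::complex_vector \<Rightarrow> 'd \<Rightarrow> complex" and j :: "'d \<Rightarrow> 'h::chilbert_space" and \<gamma> :: real
  assumes sesq: "sesquilinear a"
    and clin: "clinear j"
    and accr: "accretive a"
    and sect: "j_sectorial a j \<gamma>"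
begin

lemma a_simps:
  "a (u + v) w = a u w + a v w" "a w (u + v) = a w u + a w v"
  "a (c *\<^sub>C u) w = c * a u w" "a w (c *\<^sub>C u) = cnj c * a w u"
  using sesq by (simp_all add: sesquilinear_def)

lemma j_add: "j (u + v) = j u + j v"
  and j_scaleC: "j (c *\<^sub>C u) = c *\<^sub>C j u"
  and j_scaleR: "j (complex_of_real r *\<^sub>C u) = r *\<^sub>R j u"
  using clin by (simp_all add: clinear_def scaleR_scaleC)

lemma j_minus: "j (- u) = - j u"
  by (simp only: scaleC_minus1[of u] j_scaleR) simp

lemma j_diff: "j (u - v) = j u - j v"
  using j_add[of u "-v"] by (simp add: j_minus)

lemma j_zero: "j 0 = 0" using j_diff[of 0 0] by simp

lemma a_accretive: "0 \<le> Re (a u u)" using accr by (simp add: accretive_def)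

section \<open>Symmetric and antisymmetric parts of the real part of the form\<close>

text \<open>The shift is a parameter because three values matter: \<open>-\<gamma>\<close> expresses
  sectoriality, \<open>1 - \<gamma>\<close> gives the form norm, and large \<open>\<mu>\<close>
  gives the resolvent equation.\<close>

definition herm :: "real \<Rightarrow> 'd \<Rightarrow> 'd \<Rightarrow> real" where
  "herm \<mu> u v = (Re (a u v) + Re (a v u)) / 2 + \<mu> * inner (j u) (j v)"

definition skew :: "'d \<Rightarrow> 'd \<Rightarrow> real" where
  "skew u v = (Re (a u v) - Re (a v u)) / 2"

lemma Re_a: "Re (a u v) = herm \<mu> u v + skew u v - \<mu> * inner (j u) (j v)"
  by (simp add: herm_def skew_def field_simps)

lemma herm_self: "herm \<mu> u u = Re (a u u) + \<mu> * (norm (j u))\<^sup>2"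
  by (simp add: herm_def power2_norm_eq_inner)

lemma real_functional_herm: "real_functional (herm \<mu> u)"
  unfolding real_functional_def herm_def
  by (simp add: a_simps j_add j_scaleR inner_simps algebra_simps add_divide_distrib)

lemma herm_sym: "herm \<mu> u v = herm \<mu> v u"
  by (simp add: herm_def inner_commute add.commute)

lemma real_functional_skew: "real_functional (skew u)"
  unfolding real_functional_def skew_def
  by (simp add: a_simps algebra_simps add_divide_distrib diff_divide_distrib)

lemma sector_bound:
  obtains M where "0 \<le> M" "\<And>u. 0 \<le> herm (-\<gamma>) u u" "\<And>u. \<bar>Im (a u u)\<bar> \<le> M * herm (-\<gamma>) u u"
proof -
  obtain \<theta> where \<theta>: "0 \<le> \<theta>" "\<theta> < pi / 2"
    "\<And>u. a u u - complex_of_real (\<gamma> * (norm (j u))\<^sup>2) \<in> sector \<theta>"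
    using sect by (auto simp: j_sectorial_def)
  show thesis
  proof (rule that[of "tan \<theta>"])
    show "0 \<le> tan \<theta>" using \<theta> by (simp add: tan_pos_pi2_le)
    show "0 \<le> herm (-\<gamma>) u u" "\<bar>Im (a u u)\<bar> \<le> tan \<theta> * herm (-\<gamma>) u u" for u
      using sectorD[OF \<theta>(3)[of u] \<theta>(1,2)] by (simp_all add: herm_self)
  qed
qed

lemma psd_herm: "- \<gamma> \<le> \<mu> \<Longrightarrow> psd_form (herm \<mu>)"
proof
  assume "- \<gamma> \<le> \<mu>"
  then have *: "- \<gamma> * (norm (j u))\<^sup>2 \<le> \<mu> * (norm (j u))\<^sup>2" for u
    by (intro mult_right_mono) auto
  show "0 \<le> herm \<mu> u u" for u
    using sector_bound[of "0 \<le> herm (-\<gamma>) u u"] *[of u] by (simp add: herm_self)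
qed (rule real_functional_herm herm_sym)+

lemma herm_mono: "\<mu> \<le> \<nu> \<Longrightarrow> herm \<mu> u u \<le> herm \<nu> u u"
  by (simp add: herm_self mult_right_mono)

text \<open>A constant such as the tangent of the semi-angle, fixed by choice so that it can be
  named in later statements and locale instances.\<close>

definition form_bound :: real where
  "form_bound = (SOME M. 0 \<le> M \<and> (\<forall>u. \<bar>Im (a u u)\<bar> \<le> M * herm (-\<gamma>) u u))"

lemma form_bound: "0 \<le> form_bound" "\<bar>Im (a u u)\<bar> \<le> form_bound * herm (-\<gamma>) u u"
proof -
  have "\<exists>M. 0 \<le> M \<and> (\<forall>u. \<bar>Im (a u u)\<bar> \<le> M * herm (-\<gamma>) u u)"
    using sector_bound by metis
  from someI_ex[OF this] show "0 \<le> form_bound" "\<bar>Im (a u u)\<bar> \<le> form_bound * herm (-\<gamma>) u u"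
    by (auto simp: form_bound_def)
qed

text \<open>Sectoriality controls \<open>Im a\<close> on the diagonal only. Polarisation and scaling
  turn this into a Cauchy-Schwarz bound for the symmetric form \<open>k\<close> with diagonal
  \<open>Im (a u u)\<close>, and multiplying \<open>u\<close> by the imaginary unit turns
  \<open>k\<close> into \<open>skew\<close>.\<close>

lemma skew_bound_sq: "(skew u v)\<^sup>2 \<le> form_bound * herm (-\<gamma>) u u * (form_bound * herm (-\<gamma>) v v)"
proof -
  interpret p: psd_form "herm (-\<gamma>)" by (rule psd_herm) simp
  define k where "k u v = (Im (a u v) + Im (a v u)) / 2" for u v
  have klin: "k (x + y) w = k x w + k y w" "k w (x + y) = k w x + k w y"
    "k (complex_of_real t *\<^sub>C x) y = t * k x y" "k x (complex_of_real t *\<^sub>C y) = t * k x y"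
    for x y w t
    unfolding k_def by (simp_all add: a_simps algebra_simps add_divide_distrib)
  have ksym: "k x y = k y x" for x y by (simp add: k_def add.commute)
  have kneg: "k (- x) y = - k x y" "k x (- y) = - k x y" for x y
    using klin(3)[of "-1"] klin(4)[of _ "-1"] by (simp_all only: scaleC_minus1)
  have polar: "\<bar>4 * k x y\<bar> \<le> 2 * form_bound * (herm (-\<gamma>) x x + herm (-\<gamma>) y y)" for x y
  proof -
    have "4 * k x y = k (x + y) (x + y) - k (x + - y) (x + - y)"
      by (simp only: klin(1,2) kneg ksym[of y x])
    also have "\<bar>\<dots>\<bar> \<le> \<bar>k (x + y) (x + y)\<bar> + \<bar>k (x + - y) (x + - y)\<bar>" by (rule abs_triangle_ineq4)
    also have "\<dots> \<le> form_bound * herm (-\<gamma>) (x + y) (x + y) + form_bound * herm (-\<gamma>) (x - y) (x - y)"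
      using form_bound(2)[of "x + y"] form_bound(2)[of "x - y"] by (intro add_mono) (simp_all add: k_def)
    also have "\<dots> = 2 * form_bound * (herm (-\<gamma>) x x + herm (-\<gamma>) y y)"
      by (simp add: p.h_simps herm_sym[of _ y x] algebra_simps)
    finally show ?thesis .
  qed
  have k2: "(k x y)\<^sup>2 \<le> form_bound * herm (-\<gamma>) x x * (form_bound * herm (-\<gamma>) y y)" for x y
  proof (rule quadratic_nonneg_imp_discriminant)
    fix t
    show "0 \<le> form_bound * herm (-\<gamma>) x x * t\<^sup>2 + 2 * k x y * t + form_bound * herm (-\<gamma>) y y"
      \<comment> \<open>Scaling \<open>x\<close> by \<open>t\<close> makes the polarised bound a
        nonnegative quadratic polynomial in \<open>t\<close>.\<close>
      using polar[of "complex_of_real t *\<^sub>C x" y]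
      by (simp add: klin p.h_simps power2_eq_square algebra_simps abs_le_iff)
  qed (simp add: form_bound p.nonneg)
  have "skew u v = k (\<i> *\<^sub>C u) v" by (simp add: skew_def k_def a_simps)
  moreover have "herm (-\<gamma>) (\<i> *\<^sub>C u) (\<i> *\<^sub>C u) = herm (-\<gamma>) u u"
  proof -
    \<comment> \<open>The imaginary unit acts isometrically, so it preserves the symmetric part on
      the diagonal.\<close>
    have "cinner (j u) (\<i> *\<^sub>C j u) = cnj (\<i> * cinner (j u) (j u))"
      by (subst cinner_commute) (simp add: cinner_scaleC_left)
    then have "inner (\<i> *\<^sub>C j u) (\<i> *\<^sub>C j u) = inner (j u) (j u)"
      by (simp add: inner_eq_Re_cinner cinner_scaleC_left)
    then show ?thesis by (simp add: herm_def a_simps j_scaleC)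
  qed
  ultimately show ?thesis using k2[of "\<i> *\<^sub>C u" v] by (simp only:)
qed

text \<open>Raising the shift enlarges \<open>herm\<close> on the diagonal and leaves
  \<open>skew\<close> unchanged, so the bound at the shift \<open>-\<gamma>\<close>
  persists.\<close>

lemma sectorial_pair_herm: "- \<gamma> \<le> \<mu> \<Longrightarrow> sectorial_pair (herm \<mu>) skew form_bound"
proof -
  assume l: "- \<gamma> \<le> \<mu>"
  interpret p: psd_form "herm \<mu>" by (rule psd_herm[OF l])
  interpret p0: psd_form "herm (-\<gamma>)" by (rule psd_herm) simp
  show ?thesis
  proof
    show "\<bar>skew u v\<bar> \<le> form_bound * p.N u * p.N v" for u v
    proof (rule power2_le_imp_le)
      have "(skew u v)\<^sup>2 \<le> form_bound * herm (-\<gamma>) u u * (form_bound * herm (-\<gamma>) v v)"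
        by (rule skew_bound_sq)
      also have "\<dots> \<le> form_bound * herm \<mu> u u * (form_bound * herm \<mu> v v)"
        using l by (intro mult_mono[OF mult_left_mono mult_left_mono] herm_mono
            mult_nonneg_nonneg form_bound(1) p.nonneg p0.nonneg)
      also have "\<dots> = (form_bound * p.N u * p.N v)\<^sup>2"
        by (simp add: power_mult_distrib p.N_sq) (simp add: power2_eq_square)
      finally show "\<bar>skew u v\<bar>\<^sup>2 \<le> (form_bound * p.N u * p.N v)\<^sup>2" by simp
    qed (simp add: form_bound)
    show "skew u v = - skew v u" for u v by (simp add: skew_def field_simps)
  qed (rule real_functional_skew form_bound(1))+
qed

abbreviation nrm :: "'d \<Rightarrow> real" where "nrm \<equiv> form_norm a j \<gamma>"

lemma nrm_eq: "nrm u = psd_form.N (herm (1 - \<gamma>)) u"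
  by (simp add: form_norm_def psd_form.N_def[OF psd_herm] herm_self)

end

text \<open>With the shift \<open>1 - \<gamma>\<close> the abstract seminorm is the form norm; the
  rewrites state the abstract results directly for \<open>form_norm\<close> and
  \<open>form_Cauchy\<close>.\<close>

sublocale sectorial_form \<subseteq> V: sectorial_pair "herm (1 - \<gamma>)" skew form_bound
  rewrites "psd_form.N (herm (1 - \<gamma>)) = form_norm a j \<gamma>"
    and "psd_form.N_Cauchy (herm (1 - \<gamma>)) = form_Cauchy a j \<gamma>"
proof -
  show p: "sectorial_pair (herm (1 - \<gamma>)) skew form_bound" by (rule sectorial_pair_herm) simp
  then have q: "psd_form (herm (1 - \<gamma>))" by (simp add: sectorial_pair_def)
  show eq: "psd_form.N (herm (1 - \<gamma>)) = form_norm a j \<gamma>" using nrm_eq by auto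
  show "psd_form.N_Cauchy (herm (1 - \<gamma>)) = form_Cauchy a j \<gamma>"
    by (intro ext) (simp add: psd_form.N_Cauchy_def[OF q] form_Cauchy_def eq)
qed

context sectorial_form
begin

lemma nrm_sq: "(nrm u)\<^sup>2 = Re (a u u) + (1 - \<gamma>) * (norm (j u))\<^sup>2"
  using V.N_sq[of u] by (simp add: herm_self)

text \<open>The difference of the squares is the diagonal of \<open>herm (-\<gamma>)\<close>,
  nonnegative by sectoriality.\<close>

lemma norm_j_le: "norm (j u) \<le> nrm u"
proof (rule power2_le_imp_le)
  have "0 \<le> herm (-\<gamma>) u u" using psd_form.nonneg[OF psd_herm] by simp
  then show "(norm (j u))\<^sup>2 \<le> (nrm u)\<^sup>2" by (simp add: nrm_sq herm_self algebra_simps)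
qed simp

text \<open>The summands account for the symmetric part, the antisymmetric part and the removal of
  the shift.\<close>

definition cont_bound :: real where "cont_bound = 1 + form_bound + \<bar>1 - \<gamma>\<bar>"

lemma cont_bound_nonneg: "0 \<le> cont_bound" using form_bound(1) by (simp add: cont_bound_def)

lemma Re_a_bound: "\<bar>Re (a u v)\<bar> \<le> cont_bound * nrm u * nrm v"
proof -
  have "Re (a u v) = herm (1 - \<gamma>) u v + skew u v - (1 - \<gamma>) * inner (j u) (j v)"
    by (rule Re_a)
  moreover have "\<bar>(1 - \<gamma>) * inner (j u) (j v)\<bar> \<le> \<bar>1 - \<gamma>\<bar> * (nrm u * nrm v)"
  proof -
    have "\<bar>inner (j u) (j v)\<bar> \<le> norm (j u) * norm (j v)" by (rule Cauchy_Schwarz_ineq2)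
    also have "\<dots> \<le> nrm u * nrm v" by (rule mult_mono[OF norm_j_le norm_j_le]) auto
    finally show ?thesis unfolding abs_mult by (rule mult_left_mono) simp
  qed
  ultimately have "\<bar>Re (a u v)\<bar> \<le> nrm u * nrm v + form_bound * nrm u * nrm v + \<bar>1 - \<gamma>\<bar> * (nrm u * nrm v)"
    using V.Cauchy_Schwarz[of u v] V.s_bound[of u v] by linarith
  then show ?thesis by (simp add: cont_bound_def algebra_simps)
qed

lemma real_functional_Re_a: "real_functional (\<lambda>v. Re (a u v))" "real_functional (\<lambda>v. Re (a v u))"
  unfolding real_functional_def by (simp_all add: a_simps)

lemmas Re_a_simps = real_functionalD[OF real_functional_Re_a(1)] real_functionalD[OF real_functional_Re_a(2)]

lemma form_Cauchy_bounded:
  assumes "form_Cauchy a j \<gamma> u"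
  shows "\<exists>B. \<forall>n. nrm (u n) \<le> B"
proof -
  obtain M where M: "\<And>m n. m \<ge> M \<Longrightarrow> n \<ge> M \<Longrightarrow> nrm (u m - u n) < 1"
    using assms unfolding form_Cauchy_def by (metis zero_less_one)
  define B where "B = Max ((\<lambda>n. nrm (u n)) ` {..M}) + 1"
  have le: "nrm (u n) \<le> B - 1" if "n \<le> M" for n
    using that by (simp add: B_def)
  have "nrm (u n) \<le> B" for n
  proof (cases "n \<le> M")
    case False
    then have "nrm (u n) \<le> nrm (u n - u M) + nrm (u M)"
      using V.N_triangle[of "u n - u M" "u M"] by simp
    then show ?thesis using M[of n M] False le[of M] by simp
  qed (use le in force)
  then show ?thesis by blast
qed

lemma form_Cauchy_j_convergent:
  assumes "form_Cauchy a j \<gamma> u"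
  obtains y where "(\<lambda>n. j (u n)) \<longlonglongrightarrow> y"
proof -
  have "Cauchy (\<lambda>n. j (u n))"
  proof (rule metric_CauchyI)
    fix e :: real assume "0 < e"
    then obtain M where "\<And>m n. m \<ge> M \<Longrightarrow> n \<ge> M \<Longrightarrow> nrm (u m - u n) < e"
      using assms unfolding form_Cauchy_def by metis
    then show "\<exists>M. \<forall>m\<ge>M. \<forall>n\<ge>M. dist (j (u m)) (j (u n)) < e"
      unfolding dist_norm j_diff[symmetric] by (meson norm_j_le le_less_trans)
  qed
  then show thesis using that by (auto simp: Cauchy_convergent_iff convergent_def)
qed

section \<open>Testing elements of the graph, and a priori bounds\<close>

text \<open>The graph gives convergence for a fixed test vector. For moving but bounded ones,
  replacing \<open>u n\<close> by \<open>u m\<close> costs little uniformly because \<open>u\<close>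
  is Cauchy; then \<open>m\<close> tends to infinity with \<open>n\<close> fixed.\<close>

lemma graph_pairing_tendsto:
  assumes u: "form_Cauchy a j \<gamma> u" "\<And>v. (\<lambda>n. a (u n) v) \<longlonglongrightarrow> cinner f (j v)"
    and v: "\<And>n. nrm (v n) \<le> B" "(\<lambda>n. j (v n)) \<longlonglongrightarrow> z"
  shows "(\<lambda>n. Re (a (u n) (v n))) \<longlonglongrightarrow> inner f z"
proof -
  have "(\<lambda>n. Re (a (u n) (v n)) - inner f (j (v n))) \<longlonglongrightarrow> 0"
  proof (rule LIMSEQ_I)
    fix e :: real assume "0 < e"
    have B: "0 \<le> B" using v(1)[of 0] V.N_nonneg[of "v 0"] by linarith
    then have KB: "0 \<le> cont_bound * B" using cont_bound_nonneg by simp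
    \<comment> \<open>Makes \<open>cont_bound * d * B\<close> smaller than \<open>e\<close>; the
      added 1 avoids a zero denominator.\<close>
    define d where "d = e / 2 / (cont_bound * B + 1)"
    have "d > 0" using \<open>0 < e\<close> KB by (simp add: d_def)
    then obtain M where M: "\<And>m n. m \<ge> M \<Longrightarrow> n \<ge> M \<Longrightarrow> nrm (u m - u n) < d"
      using u(1) unfolding form_Cauchy_def by metis
    have "\<bar>Re (a (u n) (v n)) - inner f (j (v n))\<bar> \<le> cont_bound * d * B" if "n \<ge> M" for n
    proof (rule tendsto_upperbound)
      show "(\<lambda>m. \<bar>Re (a (u n) (v n)) - Re (a (u m) (v n))\<bar>)
          \<longlonglongrightarrow> \<bar>Re (a (u n) (v n)) - inner f (j (v n))\<bar>"
        unfolding inner_eq_Re_cinner by (intro tendsto_intros u)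
      have "\<bar>Re (a (u n) (v n)) - Re (a (u m) (v n))\<bar> \<le> cont_bound * d * B" if "m \<ge> M" for m
      proof -
        have "\<bar>Re (a (u n) (v n)) - Re (a (u m) (v n))\<bar> \<le> cont_bound * nrm (u n - u m) * nrm (v n)"
          using Re_a_bound[of "u n - u m" "v n"] by (simp add: Re_a_simps)
        also have "\<dots> \<le> cont_bound * d * B"
          using M[OF \<open>n \<ge> M\<close> that] v(1)[of n] cont_bound_nonneg \<open>d > 0\<close>
          by (intro mult_mono mult_nonneg_nonneg) auto
        finally show ?thesis .
      qed
      then show "\<forall>\<^sub>F m in sequentially. \<bar>Re (a (u n) (v n)) - Re (a (u m) (v n))\<bar> \<le> cont_bound * d * B"
        by (auto simp: eventually_sequentially)
    qed simp
    moreover have "cont_bound * d * B < e"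
    proof -
      have "cont_bound * d * B = (e / 2) * ((cont_bound * B) / (cont_bound * B + 1))" by (simp add: d_def)
      also have "\<dots> \<le> (e / 2) * 1"
        using \<open>0 < e\<close> KB by (intro mult_left_mono) auto
      finally show ?thesis using \<open>0 < e\<close> by simp
    qed
    ultimately show "\<exists>no. \<forall>n\<ge>no. norm (Re (a (u n) (v n)) - inner f (j (v n)) - 0) < e"
      by (auto intro: le_less_trans)
  qed
  moreover have "(\<lambda>n. inner f (j (v n))) \<longlonglongrightarrow> inner f z" by (intro tendsto_intros v)
  ultimately show ?thesis using tendsto_add by fastforce
qed

text \<open>Links the expression in conditions (ii) and (iii) to the operator: along a sequence
  representing \<open>y\<close> it converges to an inner product with \<open>f\<close>.\<close>

lemma graph_test_limit:
  assumes "(y, f) \<in> associated_operator a j \<gamma>"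
  obtains w where "form_Cauchy a j \<gamma> w" "(\<lambda>n. j (w n)) \<longlonglongrightarrow> y"
    "\<And>v. (\<lambda>n. a (w n) v) \<longlonglongrightarrow> cinner f (j v)"
    "\<And>u. (\<lambda>n. Re (a (w n) (u - w n))) \<longlonglongrightarrow> inner f (j u - y)"
proof -
  obtain w where w: "form_Cauchy a j \<gamma> w" "(\<lambda>n. j (w n)) \<longlonglongrightarrow> y"
    "\<And>v. (\<lambda>n. a (w n) v) \<longlonglongrightarrow> cinner f (j v)"
    using assms by (auto simp: associated_operator_def)
  obtain B where B: "\<And>n. nrm (w n) \<le> B" using form_Cauchy_bounded[OF w(1)] by blast
  have "(\<lambda>n. Re (a (w n) (u - w n))) \<longlonglongrightarrow> inner f (j u - y)" for u
  proof (rule graph_pairing_tendsto[OF w(1,3)])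
    show "nrm (u - w n) \<le> nrm u + B" for n
      using V.N_diff[of u "w n"] B[of n] by linarith
    show "(\<lambda>n. j (u - w n)) \<longlonglongrightarrow> j u - y" unfolding j_diff by (intro tendsto_intros w)
  qed
  then show thesis using that w by blast
qed

lemma graph_accretive:
  assumes "(y, f) \<in> associated_operator a j \<gamma>"
  shows "0 \<le> inner f y"
proof -
  obtain w where "\<And>u. (\<lambda>n. Re (a (w n) (u - w n))) \<longlonglongrightarrow> inner f (j u - y)"
    using graph_test_limit[OF assms] by metis
  from this[of 0] have "(\<lambda>n. - Re (a (w n) (w n))) \<longlonglongrightarrow> - inner f y"
    by (simp add: j_zero Re_a_simps)
  moreover have "\<forall>\<^sub>F n in sequentially. - Re (a (w n) (w n)) \<le> 0"
    using a_accretive by simp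
  ultimately have "- inner f y \<le> 0" by (rule tendsto_upperbound) simp
  then show ?thesis by simp
qed

text \<open>Completing the square in \<open>nrm w\<close> absorbs the form norm of \<open>w\<close>,
  leaving only the norm of \<open>j w\<close>.\<close>

lemma test_upper_bound: "Re (a w (u - w)) \<le> (cont_bound * nrm u)\<^sup>2 / 4 + \<bar>1 - \<gamma>\<bar> * (norm (j w))\<^sup>2"
proof -
  have "Re (a w w) = (nrm w)\<^sup>2 - (1 - \<gamma>) * (norm (j w))\<^sup>2" by (simp add: nrm_sq)
  moreover have "Re (a w u) \<le> cont_bound * nrm w * nrm u" using Re_a_bound[of w u] by linarith
  moreover have "0 \<le> (nrm w - cont_bound * nrm u / 2)\<^sup>2" by simp
  then have "cont_bound * nrm w * nrm u \<le> (nrm w)\<^sup>2 + (cont_bound * nrm u)\<^sup>2 / 4"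
    by (simp add: power2_diff power_divide algebra_simps)
  moreover have "(1 - \<gamma>) * (norm (j w))\<^sup>2 \<le> \<bar>1 - \<gamma>\<bar> * (norm (j w))\<^sup>2"
    by (intro mult_right_mono) auto
  ultimately show ?thesis unfolding Re_a_simps(3) by linarith
qed

text \<open>The lower bound is a quadratic inequality for \<open>nrm w\<close>, which yields form
  boundedness from boundedness of \<open>j w\<close>. When \<open>nrm w\<close> exceeds 1 it can be
  divided out.\<close>

lemma nrm_le_of_test:
  assumes "- \<delta> \<le> Re (a w (u - w))" "0 \<le> \<delta>"
  shows "nrm w \<le> cont_bound * nrm u + \<bar>1 - \<gamma>\<bar> * (norm (j w))\<^sup>2 + \<delta> + 1"
proof (cases "nrm w \<le> 1")
  case True
  then show ?thesis using cont_bound_nonneg V.N_nonneg[of u] assms(2) by (smt (verit) mult_nonneg_nonneg zero_le_power2 abs_ge_zero)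
next
  case False
  have "Re (a w w) = (nrm w)\<^sup>2 - (1 - \<gamma>) * (norm (j w))\<^sup>2" by (simp add: nrm_sq)
  moreover have "Re (a w u) \<le> cont_bound * nrm w * nrm u" using Re_a_bound[of w u] by linarith
  moreover have "(1 - \<gamma>) * (norm (j w))\<^sup>2 \<le> \<bar>1 - \<gamma>\<bar> * (norm (j w))\<^sup>2"
    by (intro mult_right_mono) auto
  ultimately have "(nrm w)\<^sup>2 \<le> cont_bound * nrm u * nrm w + (\<bar>1 - \<gamma>\<bar> * (norm (j w))\<^sup>2 + \<delta>)"
    using assms(1) unfolding Re_a_simps(3) by (simp add: mult_ac)
  also have "\<dots> \<le> cont_bound * nrm u * nrm w + (\<bar>1 - \<gamma>\<bar> * (norm (j w))\<^sup>2 + \<delta>) * nrm w"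
    using False assms(2) mult_left_mono[of 1 "nrm w" "\<bar>1 - \<gamma>\<bar> * (norm (j w))\<^sup>2 + \<delta>"] by simp
  finally have "nrm w * nrm w \<le> (cont_bound * nrm u + (\<bar>1 - \<gamma>\<bar> * (norm (j w))\<^sup>2 + \<delta>)) * nrm w"
    by (simp add: power2_eq_square algebra_simps)
  then have "nrm w \<le> cont_bound * nrm u + (\<bar>1 - \<gamma>\<bar> * (norm (j w))\<^sup>2 + \<delta>)"
    by (rule mult_right_le_imp_le) (use False in simp)
  then show ?thesis by simp
qed

section \<open>Resolvents and their convergence\<close>

text \<open>Here \<open>y\<close> is \<open>\<mu>\<close> times the resolvent
  \<open>(\<mu> + A)\<close> inverse applied to \<open>x\<close>. The real part of its weak equation
  is solved by \<open>Lax_Milgram_Cauchy\<close> for \<open>herm \<mu>\<close>, whose seminorm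
  dominates the form norm, so the solution sequence is also form Cauchy.\<close>

lemma resolvent_exists:
  assumes "\<mu> > 0" "1 - \<gamma> \<le> \<mu>"
  obtains y where "(y, \<mu> *\<^sub>R (x - y)) \<in> associated_operator a j \<gamma>"
proof -
  interpret R: sectorial_pair "herm \<mu>" skew form_bound
    by (rule sectorial_pair_herm) (use assms in simp)
  have nle: "nrm u \<le> R.N u" for u
    unfolding nrm_eq R.N_def psd_form.N_def[OF psd_herm, of "1 - \<gamma>", simplified]
    using herm_mono[OF assms(2)] by simp
  define F where "F v = \<mu> * inner x (j v)" for v
  have "real_functional F" unfolding F_def real_functional_def
    by (simp add: j_add j_scaleR inner_simps algebra_simps)
  moreover have "\<bar>F v\<bar> \<le> (\<mu> * norm x) * R.N v" for v
  proof -
    have "\<bar>F v\<bar> \<le> \<mu> * (norm x * norm (j v))"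
      using assms Cauchy_Schwarz_ineq2[of x "j v"] by (simp add: F_def abs_mult)
    also have "\<dots> \<le> \<mu> * (norm x * R.N v)"
      using assms norm_j_le[of v] nle[of v] by (intro mult_left_mono) auto
    finally show ?thesis by (simp add: mult.assoc)
  qed
  ultimately obtain u where u: "R.N_Cauchy u" "\<And>v. (\<lambda>n. herm \<mu> (u n) v + skew (u n) v) \<longlonglongrightarrow> F v"
    using R.Lax_Milgram_Cauchy by blast
  have C: "form_Cauchy a j \<gamma> u"
    using u(1) unfolding R.N_Cauchy_def form_Cauchy_def by (meson nle le_less_trans)
  obtain y where y: "(\<lambda>n. j (u n)) \<longlonglongrightarrow> y" using form_Cauchy_j_convergent[OF C] .
  have re: "(\<lambda>n. Re (a (u n) v)) \<longlonglongrightarrow> Re (cinner (\<mu> *\<^sub>R (x - y)) (j v))" for v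
  proof -
    have "(\<lambda>n. Re (a (u n) v)) \<longlonglongrightarrow> F v - \<mu> * inner y (j v)"
      unfolding Re_a[of _ v \<mu>] by (intro tendsto_intros u y)
    then show ?thesis
      by (simp add: F_def inner_eq_Re_cinner[symmetric] inner_simps algebra_simps)
  qed
  have im: "(\<lambda>n. Im (a (u n) v)) \<longlonglongrightarrow> Im (cinner (\<mu> *\<^sub>R (x - y)) (j v))" for v
  proof -
    \<comment> \<open>Testing with \<open>v\<close> multiplied by the imaginary unit recovers the
      imaginary part from the real part.\<close>
    have "cinner z (\<i> *\<^sub>C w) = - \<i> * cinner z w" for z w :: 'h
      by (subst cinner_commute) (simp add: cinner_scaleC_left cinner_commute[of z w])
    then show ?thesis using re[of "\<i> *\<^sub>C v"] by (simp add: a_simps j_scaleC)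
  qed
  have "(\<lambda>n. a (u n) v) \<longlonglongrightarrow> cinner (\<mu> *\<^sub>R (x - y)) (j v)" for v
    using re im by (simp add: tendsto_complex_iff)
  then show thesis using that C y by (auto simp: associated_operator_def)
qed

text \<open>For the resolvent of \<open>j u\<close> the limit in \<open>graph_test_limit\<close> is
  the left-hand side, while \<open>test_upper_bound\<close> limits it independently of
  \<open>\<mu>\<close>. Accretivity gives \<open>norm y \<le> norm (j u)\<close>.\<close>

lemma resolvent_error_bound:
  assumes "(y, \<mu> *\<^sub>R (j u - y)) \<in> associated_operator a j \<gamma>" "\<mu> > 0"
  shows "\<mu> * (norm (j u - y))\<^sup>2 \<le> (cont_bound * nrm u)\<^sup>2 / 4 + \<bar>1 - \<gamma>\<bar> * (norm (j u))\<^sup>2"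
proof -
  obtain w where w: "(\<lambda>n. j (w n)) \<longlonglongrightarrow> y"
    "(\<lambda>n. Re (a (w n) (u - w n))) \<longlonglongrightarrow> inner (\<mu> *\<^sub>R (j u - y)) (j u - y)"
    using graph_test_limit[OF assms(1)] by metis
  have "inner (\<mu> *\<^sub>R (j u - y)) (j u - y) \<le> (cont_bound * nrm u)\<^sup>2 / 4 + \<bar>1 - \<gamma>\<bar> * (norm y)\<^sup>2"
  proof (rule tendsto_le[OF _ _ w(2)])
    show "(\<lambda>n. (cont_bound * nrm u)\<^sup>2 / 4 + \<bar>1 - \<gamma>\<bar> * (norm (j (w n)))\<^sup>2)
        \<longlonglongrightarrow> (cont_bound * nrm u)\<^sup>2 / 4 + \<bar>1 - \<gamma>\<bar> * (norm y)\<^sup>2"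
      by (intro tendsto_intros w)
  qed (rule sequentially_bot always_eventually allI test_upper_bound)+
  moreover have "norm y \<le> norm (j u)"
  proof -
    have "0 \<le> inner (j u - y) y" using graph_accretive[OF assms(1)] assms(2) by (simp add: zero_le_mult_iff)
    then have "norm y * norm y \<le> inner (j u) y" by (simp add: inner_simps power2_norm_eq_inner[symmetric] power2_eq_square)
    also have "\<dots> \<le> norm (j u) * norm y" by (rule norm_cauchy_schwarz)
    finally show ?thesis by (cases "y = 0") auto
  qed
  then have "\<bar>1 - \<gamma>\<bar> * (norm y)\<^sup>2 \<le> \<bar>1 - \<gamma>\<bar> * (norm (j u))\<^sup>2"
    by (intro mult_left_mono power_mono) auto
  ultimately show ?thesis by (simp add: power2_norm_eq_inner)
qed

text \<open>The threshold serves every larger \<open>\<mu>\<close>, so \<open>\<mu>\<close> can be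
  increased further to meet other constraints.\<close>

lemma resolvent_tendsto:
  assumes "e > 0"
  obtains \<mu>0 where "\<And>\<mu> y. \<mu> \<ge> \<mu>0 \<Longrightarrow> \<mu> > 0 \<Longrightarrow>
    (y, \<mu> *\<^sub>R (j u - y)) \<in> associated_operator a j \<gamma> \<Longrightarrow> norm (j u - y) < e"
proof
  define c where "c = (cont_bound * nrm u)\<^sup>2 / 4 + \<bar>1 - \<gamma>\<bar> * (norm (j u))\<^sup>2"
  fix \<mu> y assume *: "\<mu> \<ge> (c + 1) / e\<^sup>2" "\<mu> > 0" "(y, \<mu> *\<^sub>R (j u - y)) \<in> associated_operator a j \<gamma>"
  have "\<mu> * (norm (j u - y))\<^sup>2 \<le> c" unfolding c_def by (rule resolvent_error_bound[OF *(3,2)])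
  also have "c < \<mu> * e\<^sup>2" using *(1) assms by (simp add: field_simps)
  finally have "(norm (j u - y))\<^sup>2 < e\<^sup>2" using \<open>\<mu> > 0\<close> by simp
  then show "norm (j u - y) < e" using assms by (simp add: power_less_imp_less_base)
qed

section \<open>Approximants and the sequences in conditions (ii) and (iii)\<close>

text \<open>The gap between the two sides is \<open>Re (a (v - w) (v - w)) / 4\<close>, nonnegative
  by accretivity.\<close>

lemma Re_a_concave_midpoint:
  fixes u v w
  defines "m \<equiv> complex_of_real (1/2) *\<^sub>C (v + w)"
  shows "(Re (a v (u - v)) + Re (a w (u - w))) / 2 \<le> Re (a m (u - m))"
proof -
  have "Re (a m (u - m)) - (Re (a v (u - v)) + Re (a w (u - w))) / 2 = Re (a (v - w) (v - w)) / 4"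
    unfolding m_def by (simp add: Re_a_simps del: of_real_divide) (simp add: field_simps)
  then show ?thesis using a_accretive[of "v - w"] by linarith
qed

lemma approximants_imp_Cauchy:
  assumes "\<And>e. e > 0 \<Longrightarrow> \<exists>w. norm (j w - p) \<le> e \<and> - e \<le> Re (a w (u - w))"
  shows "\<exists>w. form_Cauchy a j \<gamma> w \<and> (\<lambda>n. j (w n)) \<longlonglongrightarrow> p \<and>
    (\<exists>L\<ge>0. (\<lambda>n. Re (a (w n) (u - w n))) \<longlonglongrightarrow> L)"
proof -
  define \<epsilon> where "\<epsilon> = (\<lambda>n. 1 / real (Suc n))"
  have \<epsilon>: "\<epsilon> \<longlonglongrightarrow> 0" "\<And>n. 0 < \<epsilon> n" "\<And>n. \<epsilon> n \<le> 1" "\<And>m n. m \<le> n \<Longrightarrow> \<epsilon> n \<le> \<epsilon> m"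
    using LIMSEQ_Suc[OF lim_1_over_n[where 'a = real]] by (auto simp: \<epsilon>_def field_simps)
  \<comment> \<open>Nested sets, midpoint convex by concavity of the test expression, each with a
    member of uniformly bounded form norm by \<open>nrm_le_of_test\<close>.\<close>
  define D where "D n = {w. norm (j w - p) \<le> \<epsilon> n \<and> - \<epsilon> n \<le> Re (a w (u - w))}" for n
  obtain w where w: "\<And>n. w n \<in> D n" "form_Cauchy a j \<gamma> w"
  proof (rule V.nested_midpoint_convex_Cauchy[of D "cont_bound * nrm u + \<bar>1 - \<gamma>\<bar> * (norm p + 1)\<^sup>2 + 1 + 1"])
    show "D n \<subseteq> D m" if "m \<le> n" for m n
      using \<epsilon>(4)[OF that] by (auto simp: D_def)
    show "complex_of_real (1/2) *\<^sub>C (v + w) \<in> D n" if "v \<in> D n" "w \<in> D n" for n v w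
    proof -
      have "j (complex_of_real (1/2) *\<^sub>C (v + w)) - p = (1/2) *\<^sub>R ((j v - p) + (j w - p))"
        by (simp add: j_scaleR j_add algebra_simps del: of_real_divide) (simp add: scaleR_2[symmetric] del: scaleR_2)
      then have "norm (j (complex_of_real (1/2) *\<^sub>C (v + w)) - p) \<le> (norm (j v - p) + norm (j w - p)) / 2"
        using norm_triangle_ineq[of "j v - p" "j w - p"] by (simp del: of_real_divide)
      then show ?thesis using that Re_a_concave_midpoint[of v u w] unfolding D_def mem_Collect_eq by argo
    qed
    show "\<exists>w\<in>D n. nrm w \<le> cont_bound * nrm u + \<bar>1 - \<gamma>\<bar> * (norm p + 1)\<^sup>2 + 1 + 1" for n
    proof -
      obtain w where w: "norm (j w - p) \<le> \<epsilon> n" "- \<epsilon> n \<le> Re (a w (u - w))"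
        using assms[OF \<epsilon>(2)] by blast
      then have "- 1 \<le> Re (a w (u - w))" using \<epsilon>(3)[of n] by linarith
      moreover have "norm (j w) \<le> norm p + 1"
        using w(1) \<epsilon>(3)[of n] norm_triangle_ineq[of "j w - p" p] by simp
      then have "\<bar>1 - \<gamma>\<bar> * (norm (j w))\<^sup>2 \<le> \<bar>1 - \<gamma>\<bar> * (norm p + 1)\<^sup>2"
        by (intro mult_left_mono power_mono) auto
      ultimately show ?thesis using nrm_le_of_test[of 1 w u] w unfolding D_def by force
    qed
  qed (rule that)
  have jw: "(\<lambda>n. j (w n)) \<longlonglongrightarrow> p"
    by (rule LIM_zero_cancel, rule Lim_null_comparison[OF _ \<epsilon>(1)]) (use w(1) in \<open>simp add: D_def\<close>)
  obtain B where B: "\<And>n. nrm (w n) \<le> B" using form_Cauchy_bounded[OF w(2)] by blast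
  \<comment> \<open>A form Cauchy sequence makes the test expression Cauchy as well, so a genuine
    limit exists.\<close>
  have diff: "\<bar>Re (a (w m) (u - w m)) - Re (a (w n) (u - w n))\<bar>
      \<le> (cont_bound * (nrm u + B) + cont_bound * B) * nrm (w m - w n)" for m n
  proof -
    have "Re (a (w m) (u - w m)) - Re (a (w n) (u - w n))
        = Re (a (w m - w n) (u - w m)) - Re (a (w n) (w m - w n))"
      by (simp add: Re_a_simps)
    moreover have "\<bar>Re (a (w m - w n) (u - w m))\<bar> \<le> cont_bound * nrm (w m - w n) * (nrm u + B)"
      by (rule order_trans[OF Re_a_bound])
        (use B[of m] V.N_diff[of u "w m"] cont_bound_nonneg in \<open>intro mult_left_mono, auto\<close>)
    moreover have "\<bar>Re (a (w n) (w m - w n))\<bar> \<le> cont_bound * B * nrm (w m - w n)"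
      by (rule order_trans[OF Re_a_bound])
        (use B[of n] cont_bound_nonneg in \<open>intro mult_right_mono mult_left_mono, auto\<close>)
    ultimately show ?thesis by (simp add: algebra_simps)
  qed
  define c where "c = cont_bound * (nrm u + B) + cont_bound * B + 1"
  have "B \<ge> 0" using B[of 0] V.N_nonneg[of "w 0"] by linarith
  then have "c > 0" unfolding c_def using cont_bound_nonneg V.N_nonneg[of u] by (intro add_nonneg_pos) auto
  have "Cauchy (\<lambda>n. Re (a (w n) (u - w n)))"
  proof (rule metric_CauchyI)
    fix e :: real assume "0 < e"
    then obtain M where M: "\<And>m n. m \<ge> M \<Longrightarrow> n \<ge> M \<Longrightarrow> nrm (w m - w n) < e / c"
      using w(2) \<open>c > 0\<close> unfolding form_Cauchy_def by (metis zero_less_divide_iff)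
    have "dist (Re (a (w m) (u - w m))) (Re (a (w n) (u - w n))) < e" if "m \<ge> M" "n \<ge> M" for m n
    proof -
      have "dist (Re (a (w m) (u - w m))) (Re (a (w n) (u - w n))) \<le> c * nrm (w m - w n)"
        using diff[of m n] V.N_nonneg[of "w m - w n"]
        unfolding dist_real_def c_def distrib_right[of _ 1] mult_1 by linarith
      also have "\<dots> < e" using M[OF that] \<open>c > 0\<close> by (simp add: field_simps)
      finally show ?thesis .
    qed
    then show "\<exists>M. \<forall>m\<ge>M. \<forall>n\<ge>M. dist (Re (a (w m) (u - w m))) (Re (a (w n) (u - w n))) < e" by blast
  qed
  then obtain L where L: "(\<lambda>n. Re (a (w n) (u - w n))) \<longlonglongrightarrow> L"
    by (auto simp: Cauchy_convergent_iff convergent_def)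
  have "- 0 \<le> L"
    by (rule tendsto_le[OF _ L tendsto_minus[OF \<epsilon>(1)]]) (use w(1) in \<open>auto simp: D_def\<close>)
  then show ?thesis using w(2) jw L by auto
qed

text \<open>If no approximant existed, the test expression would eventually stay below
  \<open>- e\<close> along the sequence, and so would its limit superior.\<close>

lemma limsup_imp_approximants:
  assumes "(\<lambda>n. j (w n)) \<longlonglongrightarrow> p" "limsup (\<lambda>n. ereal (Re (a (w n) (u - w n)))) \<ge> 0" "e > 0"
  shows "\<exists>w. norm (j w - p) \<le> e \<and> - e \<le> Re (a w (u - w))"
proof (rule ccontr)
  assume contra: "\<not> ?thesis"
  have "\<forall>\<^sub>F n in sequentially. norm (j (w n) - p) < e"
    using tendstoD[OF assms(1,3)] by (simp add: dist_norm)
  moreover have "ereal (Re (a (w n) (u - w n))) \<le> ereal (- e)" if "norm (j (w n) - p) < e" for n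
    unfolding ereal_less_eq using contra that by (meson less_imp_le linear)
  ultimately have "\<forall>\<^sub>F n in sequentially. ereal (Re (a (w n) (u - w n))) \<le> ereal (- e)"
    by (rule eventually_mono)
  then have "limsup (\<lambda>n. ereal (Re (a (w n) (u - w n)))) \<le> ereal (- e)"
    by (rule Limsup_bounded)
  with assms(2) have "0 \<le> ereal (- e)" by (rule order_trans)
  then show False using assms(3) by simp
qed

lemma Cauchy_imp_bounded_limsup:
  assumes "form_Cauchy a j \<gamma> w" "(\<lambda>n. Re (a (w n) (u - w n))) \<longlonglongrightarrow> L" "L \<ge> 0"
  shows "form_bounded a j \<gamma> w" "limsup (\<lambda>n. ereal (Re (a (w n) (u - w n)))) \<ge> 0"
proof -
  show "form_bounded a j \<gamma> w"
    using form_Cauchy_bounded[OF assms(1)] by (simp add: form_bounded_def)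
  have "limsup (\<lambda>n. ereal (Re (a (w n) (u - w n)))) = ereal L"
    by (rule lim_imp_Limsup) (use assms(2) in simp_all)
  then show "limsup (\<lambda>n. ereal (Re (a (w n) (u - w n)))) \<ge> 0" using assms(3) by simp
qed

end

section \<open>Projections onto closed convex sets\<close>

lemma psd_inner: "psd_form (inner :: 'h::complex_inner \<Rightarrow> 'h \<Rightarrow> real)"
  by standard (simp_all add: real_functional_def inner_simps inner_commute scaleR_scaleC[symmetric])

text \<open>Existence reuses the almost-minimal-element argument for the inner product of the space;
  uniqueness is strict convexity of the norm.\<close>

lemma projection:
  fixes C :: "'h::chilbert_space set"
  assumes C: "C \<noteq> {}" "closed C" "convex C"
  shows "projection C x \<in> C" "z \<in> C \<Longrightarrow> dist x (projection C x) \<le> dist x z"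
proof -
  interpret I: psd_form "inner :: 'h \<Rightarrow> 'h \<Rightarrow> real" by (rule psd_inner)
  have N: "I.N y = norm y" for y by (simp add: I.N_def norm_eq_sqrt_inner)
  define d where "d = infdist x C"
  \<comment> \<open>Displacements from \<open>x\<close> into \<open>C\<close>, so that the seminorm
    to be minimised is the distance from \<open>x\<close>.\<close>
  define D where "D n = {y. x + y \<in> C \<and> norm y \<le> d + 1 / real (Suc n)}" for n
  obtain y where y: "\<And>n. y n \<in> D n" "I.N_Cauchy y"
  proof (rule I.nested_midpoint_convex_Cauchy[of D "d + 1"])
    show "D n \<subseteq> D m" if "m \<le> n" for m n
    proof -
      have "1 / real (Suc n) \<le> 1 / real (Suc m)" using that by (simp add: field_simps)
      then show ?thesis by (auto simp: D_def)
    qed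
    show "complex_of_real (1/2) *\<^sub>C (v + w) \<in> D n" if "v \<in> D n" "w \<in> D n" for n v w
    proof -
      have eq: "complex_of_real (1/2) *\<^sub>C (v + w) = (1/2) *\<^sub>R (v + w)" by (rule scaleR_scaleC[symmetric])
      have "x + (1/2) *\<^sub>R (v + w) = (1/2) *\<^sub>R (x + v) + (1/2) *\<^sub>R (x + w)"
        by (simp add: algebra_simps) (simp add: scaleR_2[symmetric] del: scaleR_2)
      also have "\<dots> \<in> C" using that C(3) by (intro convexD) (auto simp: D_def)
      finally show ?thesis unfolding eq
        using that norm_triangle_ineq[of v w] by (simp add: D_def)
    qed
    show "\<exists>w\<in>D n. I.N w \<le> d + 1" for n
    proof -
      have "infdist x C < d + 1 / real (Suc n)" by (simp add: d_def)
      then obtain z where "z \<in> C" "dist x z < d + 1 / real (Suc n)"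
        using C(1) by (auto simp: infdist_def cINF_less_iff bdd_below_image_dist)
      moreover from this have "dist x z \<le> d + 1"
        using divide_le_eq_1_pos[of "real (Suc n)" 1] by linarith
      ultimately show ?thesis
        by (intro bexI[of _ "z - x"]) (auto simp: D_def N dist_norm norm_minus_commute)
    qed
  qed (rule that)
  have "Cauchy y" using y(2) unfolding I.N_Cauchy_def N by (simp add: Cauchy_def dist_norm)
  then obtain l where l: "y \<longlonglongrightarrow> l" by (auto simp: Cauchy_convergent_iff convergent_def)
  have "x + l \<in> C"
    by (rule closed_sequentially[OF C(2), of "\<lambda>n. x + y n"]) (use y(1) in \<open>auto simp: D_def intro!: tendsto_intros l\<close>)
  moreover have "norm l \<le> d + 0"
  proof (rule tendsto_le[OF _ _ tendsto_norm[OF l]])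
    show "(\<lambda>n. d + 1 / real (Suc n)) \<longlonglongrightarrow> d + 0"
      by (intro tendsto_intros LIMSEQ_Suc lim_1_over_n)
  qed (use y(1) in \<open>auto simp: D_def\<close>)
  then have "dist x (x + l) \<le> dist x z" if "z \<in> C" for z
    using infdist_le[OF that, of x] by (simp add: dist_norm d_def)
  ultimately have l_min: "x + l \<in> C \<and> (\<forall>z\<in>C. dist x (x + l) \<le> dist x z)" by blast
  then have "projection C x \<in> C \<and> (\<forall>z\<in>C. dist x (projection C x) \<le> dist x z)"
    unfolding projection_def
  proof (rule theI)
    fix z assume "z \<in> C \<and> (\<forall>z'\<in>C. dist x z \<le> dist x z')"
    with l_min show "z = x + l" by (intro any_closest_point_unique[OF C(3,2)]) auto
  qed
  then show "projection C x \<in> C" "z \<in> C \<Longrightarrow> dist x (projection C x) \<le> dist x z" by auto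
qed

lemma projection_inner_le:
  fixes C :: "'h::chilbert_space set"
  assumes C: "C \<noteq> {}" "closed C" "convex C" and "z \<in> C"
  shows "inner (x - projection C x) (z - projection C x) \<le> 0"
  by (rule any_closest_point_dot[OF C(3,2)]) (simp_all add: projection C \<open>z \<in> C\<close>)

lemma projection_lipschitz:
  fixes C :: "'h::chilbert_space set"
  assumes C: "C \<noteq> {}" "closed C" "convex C"
  shows "dist (projection C x) (projection C y) \<le> dist x y"
proof -
  have "inner (x - projection C x) (projection C y - projection C x) \<le> 0"
    and "inner (y - projection C y) (projection C x - projection C y) \<le> 0"
    by (simp_all add: projection_inner_le projection C)
  then show ?thesis unfolding dist_norm and norm_le
    using inner_ge_zero[of "(x - projection C x) - (y - projection C y)"]
    by (simp add: inner_add inner_diff inner_commute)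
qed

lemma infdist_projection:
  fixes C :: "'h::chilbert_space set"
  assumes C: "C \<noteq> {}" "closed C" "convex C"
  shows "infdist x C = norm (x - projection C x)"
proof (rule antisym)
  show "infdist x C \<le> norm (x - projection C x)"
    using infdist_le[OF projection(1)[OF C]] by (simp add: dist_norm)
  show "norm (x - projection C x) \<le> infdist x C"
    unfolding infdist_def using C(1) projection(2)[OF C, of _ x] by (auto intro!: cINF_greatest simp: dist_norm)
qed

section \<open>Strongly continuous semigroups\<close>

text \<open>A rescaled \<open>x\<close> is the difference of two points of the ball; the scaling
  \<open>c\<close> gives it length \<open>r / 2\<close>.\<close>

lemma bounded_linear_uniform_of_open:
  fixes T :: "'a::real_normed_vector \<Rightarrow> 'b::real_normed_vector"
  assumes "bounded_linear T" "r > 0" "\<And>y. y \<in> ball x0 r \<Longrightarrow> norm (T y) \<le> B"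
  shows "norm (T x) \<le> (4 * B / r) * norm x"
proof (cases "x = 0")
  case True
  then show ?thesis using linear_0[OF bounded_linear.linear[OF assms(1)]] by simp
next
  case False
  define c where "c = r / (2 * norm x)"
  have c: "c > 0" "norm (c *\<^sub>R x) < r" using False assms(2) by (simp_all add: c_def)
  have "c *\<^sub>R T x = T (x0 + c *\<^sub>R x) - T x0"
    using assms(1) by (simp add: linear_add linear_scale bounded_linear.linear)
  then have "c * norm (T x) = norm (T (x0 + c *\<^sub>R x) - T x0)"
    using c(1) by (metis abs_of_pos norm_scaleR)
  also have "\<dots> \<le> norm (T (x0 + c *\<^sub>R x)) + norm (T x0)" by (rule norm_triangle_ineq4)
  also have "\<dots> \<le> B + B"
    using c assms(2) by (intro add_mono assms(3)) (auto simp: dist_norm)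
  finally have "norm (T x) \<le> 2 * B / c" using c(1) by (simp add: field_simps)
  also have "2 * B / c = (4 * B / r) * norm x" using False by (simp add: c_def)
  finally show ?thesis .
qed

text \<open>Allow a slope \<open>e\<close>: the supremum of the times where
  \<open>g t \<le> g 0 + e * t\<close> is attained by continuity, and the Dini bound there would
  push it further unless it equals \<open>T\<close>.\<close>

lemma nonneg_right_Dini_imp_le:
  fixes g :: "real \<Rightarrow> real"
  assumes cont: "continuous_on {0..T} g" and "0 \<le> T"
    and dini: "\<And>t e. 0 \<le> t \<Longrightarrow> t < T \<Longrightarrow> e > 0 \<Longrightarrow> \<forall>\<^sub>F h in at_right 0. g (t + h) \<le> g t + e * h"
  shows "g T \<le> g 0"
proof (rule field_le_epsilon)
  fix e0 :: real assume "e0 > 0"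
  define e where "e = e0 / (T + 1)"
  have e: "e > 0" "e * T \<le> e0" using \<open>e0 > 0\<close> \<open>0 \<le> T\<close> by (simp_all add: e_def field_simps)
  define A where "A = {t \<in> {0..T}. g t - e * t \<le> g 0}"
  have "closed A" unfolding A_def
    by (intro continuous_on_closed_Collect_le continuous_intros cont)
  moreover have "0 \<in> A" using \<open>0 \<le> T\<close> by (simp add: A_def)
  moreover have bdd: "bdd_above A" by (rule bdd_aboveI[of _ T]) (simp add: A_def)
  ultimately have s: "Sup A \<in> A" by (intro closed_contains_Sup) auto
  have "Sup A = T"
  proof (rule ccontr)
    assume "Sup A \<noteq> T"
    then have lt: "Sup A < T" "0 \<le> Sup A" using s by (auto simp: A_def)
    have "\<forall>\<^sub>F h in at_right 0. h < T - Sup A \<and> 0 < h"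
      by (rule eventually_at_rightI[of 0 "T - Sup A"]) (use lt in auto)
    with dini[OF lt(2,1) e(1)]
    have "\<forall>\<^sub>F h in at_right 0. g (Sup A + h) \<le> g (Sup A) + e * h \<and> h < T - Sup A \<and> 0 < h"
      by (rule eventually_conj)
    then obtain h where h: "g (Sup A + h) \<le> g (Sup A) + e * h" "h < T - Sup A" "0 < h"
      using eventually_happens'[OF trivial_limit_at_right_real] by blast
    then have "Sup A + h \<in> A" using s lt by (auto simp: A_def algebra_simps)
    then show False using cSup_upper[OF _ bdd, of "Sup A + h"] h by simp
  qed
  then show "g T \<le> g 0 + e0" using s e by (simp add: A_def)
qed

locale c0_semigroup =
  fixes S :: "real \<Rightarrow> 'h::chilbert_space \<Rightarrow> 'h"
  assumes C0: "C0_semigroup S"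
begin

lemma bounded_linear_S: "t > 0 \<Longrightarrow> bounded_linear (S t)"
  and S_add: "s > 0 \<Longrightarrow> t > 0 \<Longrightarrow> S (s + t) x = S s (S t x)"
  and S_tendsto: "((\<lambda>t. S t x) \<longlongrightarrow> x) (at_right 0)"
  using C0 by (simp_all add: C0_semigroup_def)

lemma S_linear:
  assumes "t > 0"
  shows "S t (x + y) = S t x + S t y" "S t (x - y) = S t x - S t y" "S t (r *\<^sub>R x) = r *\<^sub>R S t x"
  using bounded_linear.linear[OF bounded_linear_S[OF assms]]
  by (simp_all add: linear_add linear_diff linear_scale)

text \<open>Uniform boundedness principle: strong continuity at 0 makes the closed sets
  \<open>E k\<close> cover the space, Baire gives one of them a ball, and linearity turns that into
  an operator bound.\<close>

lemma locally_bounded: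
  obtains \<delta> M where "\<delta> > 0" "\<And>t x. 0 < t \<Longrightarrow> t < \<delta> \<Longrightarrow> norm (S t x) \<le> M * norm x"
proof -
  \<comment> \<open>One index bounds both the length of the time interval and the norm along the
    orbit.\<close>
  define E where "E k = {x. \<forall>t. 0 < t \<and> t < 1 / real (Suc k) \<longrightarrow> norm (S t x) \<le> real (Suc k)}" for k
  have "closed (E k)" for k
  proof -
    have "E k = (\<Inter>t\<in>{t. 0 < t \<and> t < 1 / real (Suc k)}. {x. norm (S t x) \<le> real (Suc k)})"
      by (auto simp: E_def)
    also have "closed \<dots>"
    proof (intro closed_INT ballI closed_Collect_le continuous_intros)
      fix t assume "t \<in> {t. 0 < t \<and> t < 1 / real (Suc k)}"
      then show "continuous_on UNIV (S t)"
        using bounded_linear_S[of t] by (simp add: linear_continuous_on)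
    qed
    finally show ?thesis .
  qed
  moreover have "(\<Union>k. E k) = UNIV"
  proof -
    have "\<exists>k. x \<in> E k" for x
    proof -
      have "\<forall>\<^sub>F t in at_right 0. norm (S t x) < norm x + 1"
        by (rule order_tendstoD[OF tendsto_norm[OF S_tendsto]]) simp
      then obtain b where b: "b > 0" "\<And>t. 0 < t \<Longrightarrow> t < b \<Longrightarrow> norm (S t x) < norm x + 1"
        by (auto simp: eventually_at_right_field)
      obtain k where k: "real k > max (norm x + 1) (1 / b)" using reals_Archimedean2 by blast
      have "1 / real (Suc k) < b"
        using k b(1) by (simp add: field_simps)
      then have "norm (S t x) \<le> real (Suc k)" if "0 < t" "t < 1 / real (Suc k)" for t
        using b(2)[of t] k that by simp
      then have "x \<in> E k" by (simp add: E_def)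
      then show ?thesis ..
    qed
    then show ?thesis by auto
  qed
  moreover have "interior (\<Union>(range E)) = {}" if "\<And>k. interior (E k) = {}"
  proof -
    \<comment> \<open>Completeness of the Hilbert space enters here through the Baire category
      theorem.\<close>
    have "Met_TC.mtopology interior_of (\<Union>(range E)) = {}"
    proof (rule Met_TC.metric_Baire_category_alt)
      show "Met_TC.mcomplete TYPE('h)" by (simp add: complete_UNIV)
    qed (use that calculation(1) in auto)
    then show ?thesis by simp
  qed
  ultimately obtain k where "interior (E k) \<noteq> {}" by (metis UNIV_not_empty interior_UNIV)
  then obtain x0 r where r: "r > 0" "ball x0 r \<subseteq> E k"
    by (metis all_not_in_conv mem_interior)
  show thesis
  proof (rule that[of "1 / real (Suc k)" "4 * real (Suc k) / r"])
    fix t x assume "0 < t" "t < 1 / real (Suc k)"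
    then show "norm (S t x) \<le> 4 * real (Suc k) / r * norm x"
      using r by (intro bounded_linear_uniform_of_open[of _ _ x0] bounded_linear_S) (auto simp: E_def)
  qed simp
qed

text \<open>Right continuity follows from continuity at 0. For left continuity a fixed operator
  \<open>S (t - d)\<close> is factored out, and the remaining short time is governed by the local
  bound.\<close>

lemma orbit_isCont:
  assumes "t > 0"
  shows "isCont (\<lambda>s. S s x) t"
proof -
  have right: "((\<lambda>s. S s x) \<longlongrightarrow> S t x) (at_right t)"
    unfolding filterlim_at_right_to_0[of _ _ t]
  proof (rule Lim_transform_eventually)
    show "((\<lambda>h. S t (S h x)) \<longlongrightarrow> S t x) (at_right 0)"
      by (rule bounded_linear.tendsto[OF bounded_linear_S[OF assms] S_tendsto])
    show "\<forall>\<^sub>F h in at_right 0. S t (S h x) = S (h + t) x"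
      using assms by (auto simp: eventually_at_right_field S_add[symmetric] add.commute intro!: exI[of _ 1])
  qed
  obtain \<delta> M where \<delta>: "\<delta> > 0" "\<And>t x. 0 < t \<Longrightarrow> t < \<delta> \<Longrightarrow> norm (S t x) \<le> M * norm x"
    using locally_bounded by blast
  define d where "d = min \<delta> t / 2"
  have d: "d > 0" "d < \<delta>" "d < t" using \<delta>(1) assms by (auto simp: d_def)
  obtain B where B: "\<And>x. norm (S (t - d) x) \<le> norm x * B" "B > 0"
    using bounded_linear.pos_bounded[OF bounded_linear_S, of "t - d"] d by auto
  have left: "((\<lambda>s. S s x) \<longlongrightarrow> S t x) (at_left t)"
  proof (rule LIM_zero_cancel, rule Lim_null_comparison)
    have le: "norm (S s x - S t x) \<le> M * norm (x - S (t - s) x) * B" if "s > t - d" "s < t" for s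
    proof -
      let ?r = "s - (t - d)"
      have "S s x = S (t - d) (S ?r x)" using S_add[of "t - d" ?r x] that d by simp
      moreover have "S t x = S (t - d) (S ?r (S (t - s) x))"
        using S_add[of s "t - s" x] S_add[of "t - d" ?r "S (t - s) x"] that d assms by simp
      ultimately have "S s x - S t x = S (t - d) (S ?r (x - S (t - s) x))"
        using that d by (simp add: S_linear)
      then have "norm (S s x - S t x) \<le> norm (S ?r (x - S (t - s) x)) * B" using B by metis
      also have "\<dots> \<le> M * norm (x - S (t - s) x) * B"
        using B(2) that d by (intro mult_right_mono \<delta>(2)) auto
      finally show ?thesis .
    qed
    then show "\<forall>\<^sub>F s in at_left t. norm (S s x - S t x) \<le> M * norm (x - S (t - s) x) * B"
      using d by (auto simp: eventually_at_left_field intro!: exI[of _ "t - d"])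
    have "filterlim (\<lambda>s. t - s) (at_right 0) (at_left t)"
      unfolding filterlim_at
    proof
      show "((\<lambda>s. t - s) \<longlongrightarrow> 0) (at_left t)" by (auto intro!: tendsto_eq_intros)
    qed (auto simp: eventually_at_left_field intro!: exI[of _ "t - 1"])
    then have "((\<lambda>s. S (t - s) x) \<longlongrightarrow> x) (at_left t)"
      by (rule filterlim_compose[OF S_tendsto])
    then have "((\<lambda>s. M * norm (x - S (t - s) x) * B) \<longlongrightarrow> M * norm (x - x) * B) (at_left t)"
      by (intro tendsto_intros)
    then show "((\<lambda>s. M * norm (x - S (t - s) x) * B) \<longlongrightarrow> 0) (at_left t)" by simp
  qed
  show ?thesis unfolding isCont_def using left right by (rule filterlim_split_at)
qed

text \<open>Supplies the value \<open>x\<close> at time 0, where \<open>S\<close> is unconstrained,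
  so that the trajectory is continuous on closed intervals.\<close>

definition orbit :: "'h \<Rightarrow> real \<Rightarrow> 'h" where "orbit x t = (if t \<le> 0 then x else S t x)"

lemma continuous_orbit: "continuous_on {0..T} (orbit x)"
  unfolding continuous_on
proof
  fix t assume t: "t \<in> {0..T}"
  show "(orbit x \<longlongrightarrow> orbit x t) (at t within {0..T})"
  proof (cases "t = 0")
    case True
    have "(orbit x \<longlongrightarrow> orbit x t) (at_right 0)"
      by (rule Lim_transform_eventually[OF _ eventually_at_rightI[of 0 1]])
        (use S_tendsto[of x] True in \<open>auto simp: orbit_def\<close>)
    then have "(orbit x \<longlongrightarrow> orbit x t) (at 0 within {0..})"
      by (simp add: at_within_Ici_at_right)
    then show ?thesis using True by (auto intro: tendsto_within_subset)
  next
    case False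
    then have "t > 0" using t by simp
    have "(orbit x \<longlongrightarrow> orbit x t) (at t)"
    proof (rule Lim_transform_eventually)
      show "((\<lambda>s. S s x) \<longlongrightarrow> orbit x t) (at t)"
        using orbit_isCont[OF \<open>t > 0\<close>, of x] \<open>t > 0\<close> by (simp add: orbit_def isCont_def)
      have "\<forall>\<^sub>F s in at t. s > 0" using \<open>t > 0\<close> by (intro order_tendstoD(1)[OF tendsto_ident_at])
      then show "\<forall>\<^sub>F s in at t. S s x = orbit x s" by eventually_elim (simp add: orbit_def)
    qed
    then show ?thesis by (rule tendsto_within_subset) simp
  qed
qed

lemma orbit_add: "t \<ge> 0 \<Longrightarrow> h > 0 \<Longrightarrow> orbit x (t + h) = S h (orbit x t)"
  using S_add[of h t x] by (auto simp: orbit_def add.commute)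

lemma generator_diff:
  assumes "(x, f) \<in> generator S" "(y, g) \<in> generator S"
  shows "(x - y, f - g) \<in> generator S"
proof -
  have "((\<lambda>t. (1 / t) *\<^sub>R (S t x - x) - (1 / t) *\<^sub>R (S t y - y)) \<longlongrightarrow> f - g) (at_right 0)"
    using assms by (intro tendsto_diff) (simp_all add: generator_def)
  then have "((\<lambda>t. (1 / t) *\<^sub>R (S t (x - y) - (x - y))) \<longlongrightarrow> f - g) (at_right 0)"
    by (rule Lim_transform_eventually)
      (auto intro!: eventually_at_rightI[of 0 1] simp: S_linear algebra_simps)
  then show ?thesis by (simp add: generator_def)
qed

lemma generator_invariant:
  assumes "(x, f) \<in> generator S" "t > 0"
  shows "(S t x, S t f) \<in> generator S"
proof -
  have "((\<lambda>h. S t ((1 / h) *\<^sub>R (S h x - x))) \<longlongrightarrow> S t f) (at_right 0)"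
    using assms by (intro bounded_linear.tendsto[OF bounded_linear_S]) (simp_all add: generator_def)
  then have "((\<lambda>h. (1 / h) *\<^sub>R (S h (S t x) - S t x)) \<longlongrightarrow> S t f) (at_right 0)"
    by (rule Lim_transform_eventually)
      (use assms(2) in \<open>auto intro!: eventually_at_rightI[of 0 1]
         simp: S_linear S_add[symmetric] add.commute\<close>)
  then show ?thesis by (simp add: generator_def)
qed

lemma orbit_generator:
  assumes "(x, f) \<in> generator S"
  obtains g where "(orbit x t, g) \<in> generator S"
  using assms generator_invariant[OF assms, of t] by (cases "t \<le> 0") (auto simp: orbit_def)

section \<open>Distance to a convex set along orbits\<close>

text \<open>Compare with the fixed point \<open>projection C y\<close> and expand the square: the
  first-order term is \<open>2 * inner g q\<close>, nonpositive by assumption. Squaring avoids the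
  kink of the norm when \<open>y\<close> lies in \<open>C\<close>.\<close>

lemma infdist_sq_right_Dini:
  assumes C: "C \<noteq> {}" "closed C" "convex C"
    and y: "(y, g) \<in> generator S" "inner g (y - projection C y) \<le> 0" and "e > 0"
  shows "\<forall>\<^sub>F h in at_right 0. (infdist (S h y) C)\<^sup>2 \<le> (infdist y C)\<^sup>2 + e * h"
proof -
  define q where "q = y - projection C y"
  define d where "d h = (1 / h) *\<^sub>R (S h y - y)" for h
  have "((\<lambda>h. 2 * inner (d h) q + h * (norm (d h))\<^sup>2) \<longlongrightarrow> 2 * inner g q + 0 * (norm g)\<^sup>2) (at_right 0)"
    using y(1) unfolding d_def by (intro tendsto_intros) (simp_all add: generator_def)
  moreover have "2 * inner g q + 0 * (norm g)\<^sup>2 < e" using y(2) \<open>e > 0\<close> by (simp add: q_def)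
  ultimately have "\<forall>\<^sub>F h in at_right 0. 2 * inner (d h) q + h * (norm (d h))\<^sup>2 < e"
    by (rule order_tendstoD)
  moreover have "\<forall>\<^sub>F h in at_right (0::real). h > 0" by (rule eventually_at_right_less)
  ultimately show ?thesis
  proof eventually_elim
    case (elim h)
    have "infdist (S h y) C \<le> norm (S h y - projection C y)"
      using infdist_le[OF projection(1)[OF C]] by (simp add: dist_norm)
    then have "(infdist (S h y) C)\<^sup>2 \<le> (norm (S h y - projection C y))\<^sup>2"
      by (intro power_mono infdist_nonneg)
    also have "S h y - projection C y = q + h *\<^sub>R d h" using elim by (simp add: q_def d_def)
    also have "(norm (q + h *\<^sub>R d h))\<^sup>2 = (norm q)\<^sup>2 + h * (2 * inner (d h) q + h * (norm (d h))\<^sup>2)"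
      unfolding power2_norm_eq_inner
      by (simp add: inner_simps inner_commute[of q "d h"] power2_eq_square algebra_simps)
    also have "\<dots> \<le> (norm q)\<^sup>2 + h * e" using elim by (intro add_left_mono mult_left_mono) auto
    finally show ?case by (simp add: infdist_projection[OF C] q_def mult.commute)
  qed
qed

text \<open>Orbits from the domain of the generator stay in it, so the Dini estimate applies at all
  times; density and continuity in \<open>x\<close> cover the rest.\<close>

lemma infdist_nonincreasing:
  assumes C: "C \<noteq> {}" "closed C" "convex C"
    and dense: "closure (fst ` generator S) = UNIV"
    and sub: "\<And>y g. (y, g) \<in> generator S \<Longrightarrow> inner g (y - projection C y) \<le> 0"
    and "t > 0"
  shows "infdist (S t x) C \<le> infdist x C"
proof -
  have dom: "infdist (S t x) C \<le> infdist x C" if x: "x \<in> fst ` generator S" for x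
  proof -
    obtain f where xf: "(x, f) \<in> generator S" using x by auto
    have "(infdist (orbit x t) C)\<^sup>2 \<le> (infdist (orbit x 0) C)\<^sup>2"
    proof (rule nonneg_right_Dini_imp_le)
      show "continuous_on {0..t} (\<lambda>s. (infdist (orbit x s) C)\<^sup>2)"
        by (intro continuous_intros continuous_orbit)
      show "\<forall>\<^sub>F h in at_right 0. (infdist (orbit x (s + h)) C)\<^sup>2 \<le> (infdist (orbit x s) C)\<^sup>2 + e * h"
        if "0 \<le> s" "e > 0" for s e
      proof -
        obtain g where g: "(orbit x s, g) \<in> generator S" using orbit_generator[OF xf] .
        have "\<forall>\<^sub>F h in at_right (0::real). h > 0" by (rule eventually_at_right_less)
        with infdist_sq_right_Dini[OF C g sub[OF g] that(2)] show ?thesis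
          by eventually_elim (use that in \<open>simp add: orbit_add\<close>)
      qed
    qed (use \<open>t > 0\<close> in simp)
    then have "infdist (orbit x t) C \<le> infdist (orbit x 0) C"
      by (rule power2_le_imp_le) (rule infdist_nonneg)
    then show ?thesis using \<open>t > 0\<close> by (simp add: orbit_def)
  qed
  have "closed {x. infdist (S t x) C \<le> infdist x C}"
    by (rule closed_Collect_le; intro continuous_on_infdist linear_continuous_on bounded_linear_S
        continuous_on_id \<open>t > 0\<close>)
  then have "closure (fst ` generator S) \<subseteq> {x. infdist (S t x) C \<le> infdist x C}"
    using dom by (intro closure_minimal) auto
  then show ?thesis using dense by auto
qed

lemma subtangential_imp_invariant:
  assumes C: "C \<noteq> {}" "closed C" "convex C"
    and dense: "closure (fst ` generator S) = UNIV"
    and sub: "\<And>y g. (y, g) \<in> generator S \<Longrightarrow> inner g (y - projection C y) \<le> 0"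
    and "t > 0" "x \<in> C"
  shows "S t x \<in> C"
proof -
  have "infdist (S t x) C = 0"
    using infdist_nonincreasing[OF C dense sub \<open>t > 0\<close>, of x] \<open>x \<in> C\<close> infdist_nonneg[of "S t x" C] by simp
  then show ?thesis using C by (simp add: in_closed_iff_infdist_zero)
qed

text \<open>This is the case \<open>C = {0}\<close>, where the distance is the norm.\<close>

lemma dissipative_imp_contraction:
  assumes dense: "closure (fst ` generator S) = UNIV"
    and diss: "\<And>y g. (y, g) \<in> generator S \<Longrightarrow> inner g y \<le> 0"
    and "t > 0"
  shows "norm (S t x) \<le> norm x"
proof -
  have "projection {0} y = 0" for y :: 'h using projection(1)[of "{0}" y] by simp
  then have "infdist (S t x) {0} \<le> infdist x {0}"
    using diss by (intro infdist_nonincreasing dense \<open>t > 0\<close>) auto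
  then show ?thesis by simp
qed

text \<open>The generator equation says that \<open>y\<close> is the scaled resolvent of
  \<open>x\<close>. Invariance and contractivity give a nonpositive pairing of \<open>y - p\<close>
  with the difference quotient; its limit and the obtuse angle at \<open>p\<close> force
  \<open>y = p\<close>.\<close>

lemma resolvent_invariant:
  assumes C: "C \<noteq> {}" "closed C" "convex C"
    and inv: "\<And>t. t > 0 \<Longrightarrow> S t ` C \<subseteq> C"
    and contr: "\<And>t x. t > 0 \<Longrightarrow> norm (S t x) \<le> norm x"
    and y: "(y, \<mu> *\<^sub>R (y - x)) \<in> generator S" "\<mu> > 0" "x \<in> C"
  shows "y \<in> C"
proof -
  define p where "p = projection C y"
  have pC: "p \<in> C" using projection(1)[OF C] by (simp add: p_def)
  have le: "inner (y - p) ((1 / t) *\<^sub>R (S t y - y)) \<le> 0" if "t > 0" for t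
  proof -
    have "inner (y - p) (S t p - p) \<le> 0"
      using projection_inner_le[OF C, of "S t p" y] inv[OF that] pC by (auto simp: p_def)
    moreover have "inner (y - p) (S t (y - p)) \<le> inner (y - p) (y - p)"
    proof -
      have "inner (y - p) (S t (y - p)) \<le> norm (y - p) * norm (S t (y - p))" by (rule norm_cauchy_schwarz)
      also have "\<dots> \<le> norm (y - p) * norm (y - p)" by (intro mult_left_mono contr that) simp
      finally show ?thesis by (simp add: power2_norm_eq_inner[symmetric] power2_eq_square)
    qed
    \<comment> \<open>Split \<open>S t y - y\<close> into \<open>S t p - p\<close> and
      \<open>S t (y - p) - (y - p)\<close>.\<close>
    ultimately have "inner (y - p) (S t y - y) \<le> 0"
      using that by (simp add: S_linear inner_simps)
    then show ?thesis using that by (simp add: divide_nonpos_pos)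
  qed
  have "inner (y - p) (\<mu> *\<^sub>R (y - x)) \<le> 0"
  proof (rule tendsto_upperbound)
    show "((\<lambda>t. inner (y - p) ((1 / t) *\<^sub>R (S t y - y))) \<longlongrightarrow> inner (y - p) (\<mu> *\<^sub>R (y - x))) (at_right 0)"
      using y(1) by (intro tendsto_inner tendsto_const) (simp add: generator_def)
    show "\<forall>\<^sub>F t in at_right 0. inner (y - p) ((1 / t) *\<^sub>R (S t y - y)) \<le> 0"
      by (rule eventually_mono[OF eventually_at_right_less le])
  qed simp
  then have "inner (y - p) (y - x) \<le> 0" using y(2) by (simp add: mult_le_0_iff)
  moreover have "inner (y - p) (x - p) \<le> 0"
    using projection_inner_le[OF C y(3)] by (simp add: p_def)
  ultimately have "inner (y - p) (y - p) \<le> 0" by (simp add: inner_simps)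
  then have "y = p" by (metis inner_gt_zero_iff not_le right_minus_eq)
  then show ?thesis using pC by simp
qed

end

section \<open>Invariance\<close>

locale form_semigroup = sectorial_form a j \<gamma> + c0_semigroup S
  for a :: "'d::complex_vector \<Rightarrow> 'd \<Rightarrow> complex" and j :: "'d \<Rightarrow> 'h::chilbert_space" and \<gamma>
    and S :: "real \<Rightarrow> 'h \<Rightarrow> 'h" +
  assumes dense_j: "closure (range j) = UNIV"
    and generator_eq: "generator S = neg_operator (associated_operator a j \<gamma>)"
begin

lemma generator_iff: "(y, g) \<in> generator S \<longleftrightarrow> (y, - g) \<in> associated_operator a j \<gamma>"
  unfolding generator_eq neg_operator_def by force

lemma generator_dissipative: "(y, g) \<in> generator S \<Longrightarrow> inner g y \<le> 0"
  using graph_accretive[of y "- g"] by (simp add: generator_iff)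

text \<open>Approximate \<open>x\<close> by some \<open>j u\<close>, where
  \<open>resolvent_tendsto\<close> applies; the scaled resolvent is a contraction, so passing back
  to \<open>x\<close> costs at most another \<open>e / 3\<close>.\<close>

lemma resolvent_close:
  assumes "e > 0"
  obtains \<mu> y where "\<mu> > 0" "(y, \<mu> *\<^sub>R (x - y)) \<in> associated_operator a j \<gamma>" "norm (x - y) < e"
proof -
  obtain u where u: "norm (x - j u) < e / 3"
    using dense_j closure_approachable[of x "range j"] assms
    by (metis UNIV_I dist_commute dist_norm divide_pos_pos imageE zero_less_numeral)
  obtain \<mu>0 where \<mu>0: "\<And>\<mu> y. \<mu> \<ge> \<mu>0 \<Longrightarrow> \<mu> > 0 \<Longrightarrow>
      (y, \<mu> *\<^sub>R (j u - y)) \<in> associated_operator a j \<gamma> \<Longrightarrow> norm (j u - y) < e / 3"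
    using resolvent_tendsto[of "e / 3" u] assms by auto
  define \<mu> where "\<mu> = max (max \<mu>0 (1 - \<gamma>)) 1"
  have \<mu>: "\<mu> \<ge> \<mu>0" "\<mu> > 0" "1 - \<gamma> \<le> \<mu>" by (auto simp: \<mu>_def)
  obtain y' where y': "(y', \<mu> *\<^sub>R (j u - y')) \<in> associated_operator a j \<gamma>"
    using resolvent_exists[OF \<mu>(2,3)] .
  obtain y where y: "(y, \<mu> *\<^sub>R (x - y)) \<in> associated_operator a j \<gamma>"
    using resolvent_exists[OF \<mu>(2,3)] .
  have "norm (x - y) < e"
  proof -
    let ?d = "y - y'"
    have "(y, - (\<mu> *\<^sub>R (x - y))) \<in> generator S" "(y', - (\<mu> *\<^sub>R (j u - y'))) \<in> generator S"
      using y y' by (simp_all add: generator_iff)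
    \<comment> \<open>Dissipativity of the difference of the two resolvent equations gives the
      contraction.\<close>
    then have "inner (- (\<mu> *\<^sub>R (x - y)) - - (\<mu> *\<^sub>R (j u - y'))) ?d \<le> 0"
      by (intro generator_dissipative generator_diff)
    also have "- (\<mu> *\<^sub>R (x - y)) - - (\<mu> *\<^sub>R (j u - y')) = \<mu> *\<^sub>R (?d - (x - j u))"
      by (simp add: algebra_simps)
    finally have "inner ?d ?d \<le> inner (x - j u) ?d"
      using \<mu>(2) by (simp add: mult_le_0_iff inner_diff_left[of ?d "x - j u" ?d] del: inner_diff_left inner_diff_right)
    also have "\<dots> \<le> norm (x - j u) * norm ?d" by (rule norm_cauchy_schwarz)
    finally have "norm ?d * norm ?d \<le> norm (x - j u) * norm ?d"
      by (simp add: power2_norm_eq_inner[symmetric] power2_eq_square)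
    then have "norm ?d \<le> norm (x - j u)" by (cases "?d = 0") auto
    moreover have "norm (j u - y') < e / 3" by (rule \<mu>0[OF \<mu>(1,2) y'])
    moreover have "norm ((x - j u) + (j u - y') - ?d) \<le> norm (x - j u) + norm (j u - y') + norm ?d"
      using norm_triangle_ineq4[of "(x - j u) + (j u - y')" ?d]
        norm_triangle_ineq[of "x - j u" "j u - y'"] by linarith
    then have "norm (x - y) \<le> norm (x - j u) + norm (j u - y') + norm ?d" by simp
    ultimately show ?thesis using u by linarith
  qed
  with \<mu>(2) y show thesis by (rule that)
qed

lemma dense_generator: "closure (fst ` generator S) = UNIV"
proof -
  have "x \<in> closure (fst ` generator S)" for x
    unfolding closure_approachable
  proof (intro allI impI)
    fix e :: real assume "e > 0"
    then obtain \<mu> y where y: "(y, \<mu> *\<^sub>R (x - y)) \<in> associated_operator a j \<gamma>" "norm (x - y) < e"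
      using resolvent_close by metis
    then have "(y, - (\<mu> *\<^sub>R (x - y))) \<in> generator S" by (simp add: generator_iff)
    then show "\<exists>y\<in>fst ` generator S. dist y x < e"
      using y(2) by (force simp: dist_norm norm_minus_commute)
  qed
  then show ?thesis by auto
qed

lemma S_contraction: "t > 0 \<Longrightarrow> norm (S t x) \<le> norm x"
  by (rule dissipative_imp_contraction[OF dense_generator generator_dissipative])

text \<open>By \<open>resolvent_invariant\<close> the resolvent point \<open>y\<close> lies in
  \<open>C\<close>. The obtuse angle at the projection then makes the limit of the test expression
  nonnegative, and a late member of a sequence representing \<open>y\<close> is the
  approximant.\<close>

lemma invariant_imp_approximants:
  assumes C: "C \<noteq> {}" "closed C" "convex C" and inv: "\<And>t. t > 0 \<Longrightarrow> S t ` C \<subseteq> C" and "e > 0"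
  shows "\<exists>w. norm (j w - projection C (j u)) \<le> e \<and> - e \<le> Re (a w (u - w))"
proof -
  define x where "x = projection C (j u)"
  have xC: "x \<in> C" using projection(1)[OF C] by (simp add: x_def)
  obtain \<mu> y where \<mu>: "\<mu> > 0" and y: "(y, \<mu> *\<^sub>R (x - y)) \<in> associated_operator a j \<gamma>" "norm (x - y) < e"
    using resolvent_close[OF \<open>e > 0\<close>] .
  have "- (\<mu> *\<^sub>R (y - x)) = \<mu> *\<^sub>R (x - y)" by (simp add: algebra_simps)
  then have "(y, \<mu> *\<^sub>R (y - x)) \<in> generator S" using y(1) by (simp add: generator_iff)
  then have yC: "y \<in> C" using resolvent_invariant[OF C] inv S_contraction \<mu> xC by blast
  obtain w where w: "(\<lambda>n. j (w n)) \<longlonglongrightarrow> y"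
    "(\<lambda>n. Re (a (w n) (u - w n))) \<longlonglongrightarrow> inner (\<mu> *\<^sub>R (x - y)) (j u - y)"
    using graph_test_limit[OF y(1)] by metis
  have "inner (j u - x) (y - x) \<le> 0" unfolding x_def by (rule projection_inner_le[OF C yC])
  moreover have "inner (x - y) (j u - y) = inner (x - y) (x - y) - inner (j u - x) (y - x)"
    by (simp add: inner_simps inner_commute)
  moreover have "0 \<le> inner (x - y) (x - y)" by simp
  ultimately have "0 \<le> inner (x - y) (j u - y)" by linarith
  then have "- e < inner (\<mu> *\<^sub>R (x - y)) (j u - y)"
    using \<mu> \<open>e > 0\<close> mult_nonneg_nonneg[of \<mu> "inner (x - y) (j u - y)"] by (simp del: mult_nonneg_nonneg)
  then have "\<forall>\<^sub>F n in sequentially. - e < Re (a (w n) (u - w n))"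
    by (rule order_tendstoD(1)[OF w(2)])
  moreover have "(\<lambda>n. norm (j (w n) - x)) \<longlonglongrightarrow> norm (y - x)" by (intro tendsto_intros w)
  then have "\<forall>\<^sub>F n in sequentially. norm (j (w n) - x) < e"
    by (rule order_tendstoD(2)) (use y(2) in \<open>simp add: norm_minus_commute\<close>)
  ultimately have "\<forall>\<^sub>F n in sequentially. - e < Re (a (w n) (u - w n)) \<and> norm (j (w n) - x) < e"
    by (rule eventually_conj)
  then obtain n where "- e < Re (a (w n) (u - w n))" "norm (j (w n) - x) < e"
    using eventually_happens'[OF sequentially_bot] by blast
  then show ?thesis unfolding x_def by (intro exI[of _ "w n"]) simp
qed

text \<open>Accretivity moves the test inequality from \<open>Re a (w n) (u n - w n)\<close> to
  \<open>Re a (u n) (u n - w n)\<close>, whose first argument represents a graph element. The limit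
  is the tangency condition of \<open>subtangential_imp_invariant\<close>.\<close>

lemma approximants_imp_invariant:
  assumes C: "C \<noteq> {}" "closed C" "convex C"
    and approx: "\<And>u e. e > 0 \<Longrightarrow> \<exists>w. norm (j w - projection C (j u)) \<le> e \<and> - e \<le> Re (a w (u - w))"
    and "t > 0"
  shows "S t ` C \<subseteq> C"
proof -
  have "inner g (y - projection C y) \<le> 0" if "(y, g) \<in> generator S" for y g
  proof -
    define f where "f = - g"
    have "(y, f) \<in> associated_operator a j \<gamma>" using that by (simp add: generator_iff f_def)
    then obtain u where u: "form_Cauchy a j \<gamma> u" "(\<lambda>n. j (u n)) \<longlonglongrightarrow> y"
      "\<And>v. (\<lambda>n. a (u n) v) \<longlonglongrightarrow> cinner f (j v)"
      using graph_test_limit by metis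
    define \<epsilon> where "\<epsilon> = (\<lambda>n. 1 / real (Suc n))"
    have \<epsilon>: "\<epsilon> \<longlonglongrightarrow> 0" "\<And>n. 0 < \<epsilon> n" "\<And>n. \<epsilon> n \<le> 1"
      using LIMSEQ_Suc[OF lim_1_over_n[where 'a = real]] by (auto simp: \<epsilon>_def field_simps)
    have "\<forall>n. \<exists>w. norm (j w - projection C (j (u n))) \<le> \<epsilon> n \<and> - \<epsilon> n \<le> Re (a w (u n - w))"
      using approx[OF \<epsilon>(2)] by blast
    then obtain w where w: "\<And>n. norm (j (w n) - projection C (j (u n))) \<le> \<epsilon> n"
      "\<And>n. - \<epsilon> n \<le> Re (a (w n) (u n - w n))" by metis
    \<comment> \<open>The projection is nonexpansive, so \<open>projection C (j (u n))\<close> tends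
      to \<open>projection C y\<close>.\<close>
    have "(\<lambda>n. j (w n) - projection C y) \<longlonglongrightarrow> 0"
    proof (rule Lim_null_comparison)
      have "norm (j (w n) - projection C y) \<le> \<epsilon> n + norm (j (u n) - y)" for n
        using w(1)[of n] projection_lipschitz[OF C, of "j (u n)" y]
          norm_triangle_ineq[of "j (w n) - projection C (j (u n))" "projection C (j (u n)) - projection C y"]
        by (simp add: dist_norm)
      then show "\<forall>\<^sub>F n in sequentially. norm (j (w n) - projection C y) \<le> \<epsilon> n + norm (j (u n) - y)"
        by simp
      have "(\<lambda>n. \<epsilon> n + norm (j (u n) - y)) \<longlonglongrightarrow> 0 + norm (y - y)" by (intro tendsto_intros \<epsilon> u)
      then show "(\<lambda>n. \<epsilon> n + norm (j (u n) - y)) \<longlonglongrightarrow> 0" by simp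
    qed
    then have jw: "(\<lambda>n. j (w n)) \<longlonglongrightarrow> projection C y" by (rule LIM_zero_cancel)
    obtain B where B: "\<And>n. nrm (u n) \<le> B" using form_Cauchy_bounded[OF u(1)] by blast
    obtain R where R: "\<And>n. norm (j (w n)) \<le> R"
      using convergent_imp_Bseq[OF convergentI[OF jw]] by (auto simp: Bseq_def)
    \<comment> \<open>Form boundedness of \<open>w\<close> is what lets
      \<open>graph_pairing_tendsto\<close> take the moving test vectors
      \<open>u n - w n\<close>.\<close>
    have nw: "nrm (w n) \<le> cont_bound * B + \<bar>1 - \<gamma>\<bar> * R\<^sup>2 + 1 + 1" for n
    proof -
      have "- 1 \<le> Re (a (w n) (u n - w n))" using w(2)[of n] \<epsilon>(3)[of n] by linarith
      then have "nrm (w n) \<le> cont_bound * nrm (u n) + \<bar>1 - \<gamma>\<bar> * (norm (j (w n)))\<^sup>2 + 1 + 1"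
        by (rule nrm_le_of_test) simp
      also have "\<dots> \<le> cont_bound * B + \<bar>1 - \<gamma>\<bar> * R\<^sup>2 + 1 + 1"
        using B R cont_bound_nonneg by (intro add_mono mult_left_mono power_mono) auto
      finally show ?thesis .
    qed
    have lim: "(\<lambda>n. Re (a (u n) (u n - w n))) \<longlonglongrightarrow> inner f (y - projection C y)"
    proof (rule graph_pairing_tendsto[OF u(1,3)])
      show "nrm (u n - w n) \<le> B + (cont_bound * B + \<bar>1 - \<gamma>\<bar> * R\<^sup>2 + 1 + 1)" for n
        using V.N_diff[of "u n" "w n"] B[of n] nw[of n] by linarith
      show "(\<lambda>n. j (u n - w n)) \<longlonglongrightarrow> y - projection C y"
        unfolding j_diff by (intro tendsto_intros u jw)
    qed
    have "- \<epsilon> n \<le> Re (a (u n) (u n - w n))" for n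
    proof -
      have "Re (a (u n) (u n - w n)) = Re (a (u n - w n) (u n - w n)) + Re (a (w n) (u n - w n))"
        by (simp add: Re_a_simps)
      then show ?thesis using w(2)[of n] a_accretive[of "u n - w n"] by linarith
    qed
    then have "- 0 \<le> inner f (y - projection C y)"
      by (intro tendsto_le[OF sequentially_bot lim tendsto_minus[OF \<epsilon>(1)]]) simp
    then show ?thesis by (simp add: f_def)
  qed
  then show ?thesis using subtangential_imp_invariant[OF C dense_generator _ \<open>t > 0\<close>] by blast
qed

end

theorem proposition3p11:
  fixes a :: "'d::complex_vector \<Rightarrow> 'd \<Rightarrow> complex"
    and j :: "'d \<Rightarrow> 'h::chilbert_space"
    and \<gamma> :: real
    and S :: "real \<Rightarrow> 'h \<Rightarrow> 'h"
    and C :: "'h set"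
  assumes "sesquilinear a"
    and "clinear j"
    and "accretive a"
    and "j_sectorial a j \<gamma>"
    and "closure (range j) = UNIV"
    and "generates (neg_operator (associated_operator a j \<gamma>)) S"
    and "C \<noteq> {}" and "closed C" and "convex C"
  shows
    "((\<forall>t>0. S t ` C \<subseteq> C) \<longleftrightarrow>
      (\<forall>u. \<exists>w. form_Cauchy a j \<gamma> w \<and>
               (\<lambda>n. j (w n)) \<longlonglongrightarrow> projection C (j u) \<and>
               (\<exists>L\<ge>0. (\<lambda>n. Re (a (w n) (u - w n))) \<longlonglongrightarrow> L))) \<and>
     ((\<forall>u. \<exists>w. form_Cauchy a j \<gamma> w \<and>
               (\<lambda>n. j (w n)) \<longlonglongrightarrow> projection C (j u) \<and>
               (\<exists>L\<ge>0. (\<lambda>n. Re (a (w n) (u - w n))) \<longlonglongrightarrow> L)) \<longleftrightarrow>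
      (\<forall>u. \<exists>w. form_bounded a j \<gamma> w \<and>
               (\<lambda>n. j (w n)) \<longlonglongrightarrow> projection C (j u) \<and>
               limsup (\<lambda>n. ereal (Re (a (w n) (u - w n)))) \<ge> 0))"
proof -
  interpret form_semigroup a j \<gamma> S
    by unfold_locales (use assms in \<open>auto simp: generates_def\<close>)
  note C = assms(7-9)
  \<comment> \<open>Hub of the equivalence: (i) is equivalent to \<open>appr\<close>, and
    \<open>appr\<close> implies (ii), which implies (iii), which implies
    \<open>appr\<close>.\<close>
  define appr where "appr \<longleftrightarrow>
    (\<forall>u. \<forall>e>0. \<exists>w. norm (j w - projection C (j u)) \<le> e \<and> - e \<le> Re (a w (u - w)))"
  have i: "(\<forall>t>0. S t ` C \<subseteq> C) \<longleftrightarrow> appr"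
    using invariant_imp_approximants[OF C] approximants_imp_invariant[OF C]
    unfolding appr_def by blast
  have ii: "appr \<Longrightarrow> \<forall>u. \<exists>w. form_Cauchy a j \<gamma> w \<and> (\<lambda>n. j (w n)) \<longlonglongrightarrow> projection C (j u) \<and>
      (\<exists>L\<ge>0. (\<lambda>n. Re (a (w n) (u - w n))) \<longlonglongrightarrow> L)"
    by (intro allI approximants_imp_Cauchy) (simp add: appr_def)
  have iii: "\<forall>u. \<exists>w. form_Cauchy a j \<gamma> w \<and> (\<lambda>n. j (w n)) \<longlonglongrightarrow> projection C (j u) \<and>
      (\<exists>L\<ge>0. (\<lambda>n. Re (a (w n) (u - w n))) \<longlonglongrightarrow> L) \<Longrightarrow>
    \<forall>u. \<exists>w. form_bounded a j \<gamma> w \<and> (\<lambda>n. j (w n)) \<longlonglongrightarrow> projection C (j u) \<and>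
      limsup (\<lambda>n. ereal (Re (a (w n) (u - w n)))) \<ge> 0"
    using Cauchy_imp_bounded_limsup by meson
  have iv: "\<forall>u. \<exists>w. form_bounded a j \<gamma> w \<and> (\<lambda>n. j (w n)) \<longlonglongrightarrow> projection C (j u) \<and>
      limsup (\<lambda>n. ereal (Re (a (w n) (u - w n)))) \<ge> 0 \<Longrightarrow> appr"
    unfolding appr_def using limsup_imp_approximants by meson
  show ?thesis
  proof (intro conjI iffI, goal_cases)
    case 1
    show ?case by (rule ii[OF i[THEN iffD1, OF 1]])
  next
    case 2
    show ?case by (rule i[THEN iffD2, OF iv[OF iii[OF 2]]])
  next
    case 3
    show ?case by (rule iii[OF 3])
  next
    case 4
    show ?case by (rule ii[OF iv[OF 4]])
  qed
qed

end
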